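(* Let $\mathcal{F}$ be the family of all configurations in which the state of each node $v$ contains a $b$-bit string $B_v(e)$ for each incident edge $e$, and let $\mathrm{EA}_b$ ($b$-bit Edge Agreement) be the predicate which is true if and only if $B_v(e)=B_u(e)$ for every edge $e=(u,v)\in E$. Let $\alpha$ denote the arboricity and $\Delta$ the maximum degree of the underlying graph. Let $b\in\Omega(\log\Delta)$. Then for every $1\le r\le\min\{\Delta,2^{b/4}\}$, the verification complexity of $(\mathcal{F},\mathrm{EA}_b)$ in the $\mathrm{MCAST}(r)$ model is $\Theta\left(\left\lceil\frac{\alpha}{r}\right\rceil b\right)$.
   Context: A configuration $G_s$ consists of a finite connected undirected graph $G=(V,E)$ and a state $s(v)$ for each node $v$; the state contains all local input, including a unique identifier $\mathrm{ID}(v)$. The edges incident to $v$ are numbered by ports $1,\dots,d(v)$, where $d(v)$ is the degree of $v$. Let $\mathcal{F}$ be a family of configurations and $\mathcal{P}$ a boolean predicate on $\mathcal{F}$; $G_s$ is legal if $\mathcal{P}(G_s)$ is true. A proof-labeling scheme (PLS) for $(\mathcal{F},\mathcal{P})$ is a pair (prover, verifier). Given a legal $G_s$, the prover assigns each node $v$ a label $\ell(v)$ (a bit string, of any length). The verifier is a distributed one-round algorithm: each node $v$, as a function of $s(v)$ and $\ell(v)$, sends a message (bit string) on each port, then, as a function of $s(v)$, $\ell(v)$ and the messages received on each of its ports, outputs True or False. A configuration with labels is accepted if all nodes output True, and otherwise rejected. Requirements: every legal $G_s$ with the prover's labels is accepted; every illegal $G_s\in\mathcal{F}$ is rejected for every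 label assignment. $\mathrm{MCAST}(r)$ model: each node partitions its neighbors into at most $r$ groups and sends the same message to all neighbors of a group (so at most $r$ distinct messages, an empty message counting as a message). The arboricity $\alpha(G)$ is the minimum number of acyclic edge subsets covering $E$. The verification complexity of a PLS is the maximal length of a message sent by the verifier under the prover's labels in legal configurations; that of a problem is the minimum over all PLSs for it in the given model. Here it is regarded as a function of the parameters $\alpha,\Delta,b,r$: the family is restricted to configurations whose graph has arboricity $\alpha$ and maximum degree $\Delta$ (for values for which such connected graphs exist; the scheme may depend on the parameters), and the worst case over legal configurations in the restricted family is taken. Constants hidden in $\Theta$ depend only on the constant implied in $b\in\Omega(\log\Delta)$; the lower bound is asserted whenever $b$ exceeds a suitable constant. *)

theory Defs
  imports Complex_Main "HOL-Library.Extended_Nat"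
begin

section \<open>Graphs\<close>

text \<open>Vertices are natural numbers, so that one type contains all finite simple graphs up to
  isomorphism. The name of a vertex is not visible to the verifier; the identifiers that
  the verifier sees are part of the node states below.\<close>

record graph =
  verts :: "nat set"
  edges :: "nat set set"

definition simple_graph :: "'a graph_scheme \<Rightarrow> bool" where
  "simple_graph G \<longleftrightarrow> finite (verts G) \<and>
     (\<forall>e\<in>edges G. \<exists>u\<in>verts G. \<exists>v\<in>verts G. u \<noteq> v \<and> e = {u, v})"

definition connected_graph :: "'a graph_scheme \<Rightarrow> bool" where
  "connected_graph G \<longleftrightarrow> simple_graph G \<and> verts G \<noteq> {} \<and>
     (\<forall>u\<in>verts G. \<forall>v\<in>verts G. (u, v) \<in> {(x, y). {x, y} \<in> edges G}\<^sup>*)"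

definition neighbors :: "'a graph_scheme \<Rightarrow> nat \<Rightarrow> nat set" where
  "neighbors G v = {u. {v, u} \<in> edges G}"

definition degree :: "'a graph_scheme \<Rightarrow> nat \<Rightarrow> nat" where
  "degree G v = card (neighbors G v)"

definition max_degree :: "'a graph_scheme \<Rightarrow> nat" where
  "max_degree G = Max (degree G ` verts G)"

definition is_cycle :: "nat set set \<Rightarrow> nat list \<Rightarrow> bool" where
  "is_cycle F c \<longleftrightarrow> length c \<ge> 3 \<and> distinct c \<and>
     (\<forall>i<length c. {c ! i, c ! (Suc i mod length c)} \<in> F)"

definition acyclic_edges :: "nat set set \<Rightarrow> bool" where
  "acyclic_edges F \<longleftrightarrow> (\<nexists>c. is_cycle F c)"

definition arboricity :: "'a graph_scheme \<Rightarrow> nat" where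
  "arboricity G = (LEAST k. \<exists>F :: nat \<Rightarrow> nat set set.
     (\<forall>i<k. F i \<subseteq> edges G \<and> acyclic_edges (F i)) \<and> (\<Union>i<k. F i) = edges G)"


section \<open>Configurations\<close>

text \<open>\<open>port C v u\<close> is the port number at \<open>v\<close> of the edge between \<open>v\<close> and its neighbor \<open>u\<close>.
  Node states are extensible records, so that a state may contain further local input of
  any type.\<close>

record node_state =
  ident :: nat

record 's config = graph +
  port :: "nat \<Rightarrow> nat \<Rightarrow> nat"
  state :: "nat \<Rightarrow> 's"

definition configuration :: "'a node_state_scheme config \<Rightarrow> bool" where
  "configuration C \<longleftrightarrow> connected_graph C \<and>
     (\<forall>v\<in>verts C. bij_betw (port C v) (neighbors C v) {1..degree C v}) \<and>
     inj_on (\<lambda>v. ident (state C v)) (verts C)"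

definition neighbor_at :: "'s config \<Rightarrow> nat \<Rightarrow> nat \<Rightarrow> nat" where
  "neighbor_at C v i = inv_into (neighbors C v) (port C v) i"


section \<open>Proof-labeling schemes\<close>

type_synonym bits = "bool list"

text \<open>\<open>send S s l i\<close> is the message that a node with state \<open>s\<close> and label \<open>l\<close> sends on port \<open>i\<close>.
  The last list argument of \<open>decide\<close> consists of the messages received on ports 1, 2, \dots,
  in this order.\<close>

record 's pls =
  prover :: "'s config \<Rightarrow> nat \<Rightarrow> bits"
  send :: "'s \<Rightarrow> bits \<Rightarrow> nat \<Rightarrow> bits"
  decide :: "'s \<Rightarrow> bits \<Rightarrow> bits list \<Rightarrow> bool"

definition message :: "'s pls \<Rightarrow> 's config \<Rightarrow> (nat \<Rightarrow> bits) \<Rightarrow> nat \<Rightarrow> nat \<Rightarrow> bits" where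
  "message S C l v i = send S (state C v) (l v) i"

definition received :: "'s pls \<Rightarrow> 's config \<Rightarrow> (nat \<Rightarrow> bits) \<Rightarrow> nat \<Rightarrow> bits list" where
  "received S C l v =
     map (\<lambda>i. let u = neighbor_at C v i in message S C l u (port C u v)) [1..<Suc (degree C v)]"

definition accepted :: "'s pls \<Rightarrow> 's config \<Rightarrow> (nat \<Rightarrow> bits) \<Rightarrow> bool" where
  "accepted S C l \<longleftrightarrow> (\<forall>v\<in>verts C. decide S (state C v) (l v) (received S C l v))"

definition is_pls :: "'s config set \<Rightarrow> ('s config \<Rightarrow> bool) \<Rightarrow> 's pls \<Rightarrow> bool" where
  "is_pls \<F> P S \<longleftrightarrow>
     (\<forall>C\<in>\<F>. P C \<longrightarrow> accepted S C (prover S C)) \<and>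
     (\<forall>C\<in>\<F>. \<not> P C \<longrightarrow> (\<forall>l. \<not> accepted S C l))"

text \<open>The multicast restriction is a property of the algorithm: it has to hold for arbitrary
  labels, also in illegal configurations.\<close>

definition mcast :: "nat \<Rightarrow> 's config set \<Rightarrow> 's pls \<Rightarrow> bool" where
  "mcast r \<F> S \<longleftrightarrow>
     (\<forall>C\<in>\<F>. \<forall>l. \<forall>v\<in>verts C. card (message S C l v ` {1..degree C v}) \<le> r)"

definition max_message_length :: "'s config set \<Rightarrow> ('s config \<Rightarrow> bool) \<Rightarrow> 's pls \<Rightarrow> enat" where
  "max_message_length \<F> P S =
     (SUP C\<in>{C\<in>\<F>. P C}. SUP v\<in>verts C. SUP i\<in>{1..degree C v}.
        enat (length (message S C (prover S C) v i)))"

definition verification_complexity :: "nat \<Rightarrow> 's config set \<Rightarrow> ('s config \<Rightarrow> bool) \<Rightarrow> enat" where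
  "verification_complexity r \<F> P =
     (INF S\<in>{S. is_pls \<F> P S \<and> mcast r \<F> S}. max_message_length \<F> P S)"

definition restrict_family :: "nat \<Rightarrow> nat \<Rightarrow> 's config set \<Rightarrow> 's config set" where
  "restrict_family \<alpha> \<Delta> \<F> = {C\<in>\<F>. arboricity C = \<alpha> \<and> max_degree C = \<Delta>}"


section \<open>Edge agreement\<close>

text \<open>The string for the edge on port \<open>i\<close> is at position \<open>i - 1\<close> of the list.\<close>

record ea_state = node_state +
  strings :: "bits list"

definition edge_string :: "'x ea_state_scheme config \<Rightarrow> nat \<Rightarrow> nat \<Rightarrow> bits" where
  "edge_string C v u = strings (state C v) ! (port C v u - 1)"

definition EA_family :: "nat \<Rightarrow> 'x ea_state_scheme config set" where
  "EA_family b = {C. configuration C \<and>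
     (\<forall>v\<in>verts C. length (strings (state C v)) = degree C v \<and>
        (\<forall>x\<in>set (strings (state C v)). length x = b))}"

definition EA :: "'x ea_state_scheme config \<Rightarrow> bool" where
  "EA C \<longleftrightarrow> (\<forall>u v. {u, v} \<in> edges C \<longrightarrow> edge_string C v u = edge_string C u v)"

end

(* Lower bound: an edge-minimal subgraph that does not split into alpha - 1 forests has minimum
   degree at least alpha, and the parameters (alpha, Delta) are realised by such a core with
   pendant leaves attached at a single vertex u. Let the strings on the m core edges vary, all
   other strings being fixed. Distinct assignments give distinct message patterns on the core:
   otherwise an endpoint other than u of an edge where they differ could take its state and label
   from the other configuration unnoticed. A pattern is determined by the group of each of the
   at most 2m arcs and r messages per vertex, and counting patterns bounds the message length.
   Upper bound: alpha forests orient the edges with out-degree at most alpha. Each node splits its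
   outgoing edges into r groups and sends every group the strings of that group, each string tagged
   with the color of the recipient in a coloring that is injective on every neighborhood;
   O(log Delta) bits per color suffice. *)

theory Submission
  imports Defs "HOL-Library.FuncSet" "HOL-Library.Countable"
begin

text \<open>The counting needs every core vertex to have degree at least \<alpha>: with n core
  vertices the message tables carry about k r n bits, and \<alpha> n \<le> 2m turns this into 2 k r
  m / \<alpha>. A graph of arboricity \<alpha> may be sparse on average, hence the passage to a
  critical subgraph. The group choices contribute a factor r^(2m), and r \<le> 2^(b/4) keeps it
  within half of the b m bits of an assignment. The core may miss the maximum degree \<Delta>, hence
  the leaves; they all hang from one vertex because the switch argument needs a node whose edges all
  lie in the core, and every edge has an endpoint other than u. In the upper bound, a recipient has
  to find its own string in a message shared by a group. Identifiers are unbounded, and the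
  recipients' port numbers may coincide within a group, so short colors take their place. These come
  from untrusted labels, so the verifier itself checks that the colors around each node are
  distinct.\<close>

section \<open>Forests: leaves and orientations\<close>

definition simple_edges :: "nat set set \<Rightarrow> bool" where
  "simple_edges E \<longleftrightarrow> (\<forall>e\<in>E. \<exists>u v. u \<noteq> v \<and> e = {u, v})"

lemma is_cycle_mono: "is_cycle F c \<Longrightarrow> F \<subseteq> F' \<Longrightarrow> is_cycle F' c"
  unfolding is_cycle_def by blast

lemma acyclic_edges_mono: "acyclic_edges F' \<Longrightarrow> F \<subseteq> F' \<Longrightarrow> acyclic_edges F"
  unfolding acyclic_edges_def using is_cycle_mono by blast

lemma acyclic_edges_empty: "acyclic_edges {}"
  unfolding acyclic_edges_def is_cycle_def by force

text \<open>A cycle has length at least 3, so it passes through a vertex along two edges with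
  different other ends; \<open>{v, w}\<close> is the only edge at \<open>v\<close>.\<close>

lemma acyclic_edges_insert:
  assumes F: "acyclic_edges F" and v: "v \<notin> \<Union>F"
  shows "acyclic_edges (insert {v, w} F)"
  unfolding acyclic_edges_def
proof
  assume "\<exists>c. is_cycle (insert {v, w} F) c"
  then obtain c where c: "is_cycle (insert {v, w} F) c" by blast
  let ?n = "length c"
  have n: "?n \<ge> 3" and d: "distinct c"
    and e: "\<And>i. i < ?n \<Longrightarrow> {c ! i, c ! (Suc i mod ?n)} \<in> insert {v, w} F"
    using c by (auto simp: is_cycle_def)
  show False
  proof (cases "v \<in> set c")
    case False
    have "{c ! i, c ! (Suc i mod ?n)} \<in> F" if "i < ?n" for i
    proof -
      have "Suc i mod ?n < ?n" using n by (intro mod_less_divisor) auto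
      then have "v \<noteq> c ! i" "v \<noteq> c ! (Suc i mod ?n)" using False that by (metis nth_mem)+
      then show ?thesis using e[OF that] by (auto simp: doubleton_eq_iff)
    qed
    then have "is_cycle F c" using n d by (simp add: is_cycle_def)
    then show False using F by (auto simp: acyclic_edges_def)
  next
    case True
    then obtain i where i: "i < ?n" "c ! i = v" by (metis in_set_conv_nth)
    define j where "j = Suc i mod ?n"
    define k where "k = (if i = 0 then ?n - 1 else i - 1)"
    have j: "j < ?n" "j \<noteq> i" using n i unfolding j_def by (auto simp: mod_Suc)
    have k: "k < ?n" "k \<noteq> i" "Suc k mod ?n = i" using n i unfolding k_def by (auto simp: mod_Suc)
    have "j \<noteq> k" using n i unfolding j_def k_def by (auto simp: mod_Suc split: if_splits)
    have "{v, c ! j} \<in> insert {v, w} F" using e[OF i(1)] i by (simp add: j_def)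
    then have "c ! j = w" using v d i j by (auto simp: doubleton_eq_iff nth_eq_iff_index_eq)
    moreover have "{c ! k, v} \<in> insert {v, w} F" using e[OF k(1)] i k by simp
    then have "c ! k = w" using v d i k by (auto simp: doubleton_eq_iff nth_eq_iff_index_eq)
    ultimately show False using \<open>j \<noteq> k\<close> d j k by (auto simp: nth_eq_iff_index_eq)
  qed
qed

text \<open>Consecutive edges of a cycle share a vertex, so a cycle that starts in \<open>A\<close>
  can never cross to an edge of \<open>B\<close>.\<close>

lemma cycle_in_part:
  assumes c: "is_cycle (A \<union> B) c" and AB: "\<Union>A \<inter> \<Union>B = {}" and 0: "c ! 0 \<in> \<Union>A"
  shows "is_cycle A c"
proof -
  let ?n = "length c"
  have n: "?n \<ge> 3" and e: "\<And>i. i < ?n \<Longrightarrow> {c ! i, c ! (Suc i mod ?n)} \<in> A \<union> B"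
    using c by (auto simp: is_cycle_def)
  have edge: "{c ! i, c ! (Suc i mod ?n)} \<in> A" if "i < ?n" "c ! i \<in> \<Union>A" for i
    using e[OF that(1)] that(2) AB by blast
  have "i < ?n \<Longrightarrow> c ! i \<in> \<Union>A" for i
  proof (induction i)
    case 0 then show ?case using \<open>c ! 0 \<in> \<Union>A\<close> by simp
  next
    case (Suc i)
    then show ?case using edge[of i] by auto
  qed
  then show ?thesis using edge c by (simp add: is_cycle_def)
qed

lemma acyclic_edges_disjoint_Un:
  assumes A: "acyclic_edges A" and B: "acyclic_edges B" and AB: "\<Union>A \<inter> \<Union>B = {}"
  shows "acyclic_edges (A \<union> B)"
  unfolding acyclic_edges_def
proof
  assume "\<exists>c. is_cycle (A \<union> B) c"
  then obtain c where c: "is_cycle (A \<union> B) c" by blast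
  then have "{c ! 0, c ! (Suc 0 mod length c)} \<in> A \<union> B" unfolding is_cycle_def by force
  then have "c ! 0 \<in> \<Union>A \<or> c ! 0 \<in> \<Union>B" by blast
  then have "is_cycle A c \<or> is_cycle B c"
    using cycle_in_part[OF c AB] cycle_in_part[of B A c] c AB by (auto simp: Un_commute Int_commute)
  then show False using A B by (auto simp: acyclic_edges_def)
qed

text \<open>Take a longest path and its first vertex \<open>v\<close>. A second edge at
  \<open>v\<close> would either lengthen the path or, ending on it, close a cycle.\<close>

lemma forest_has_leaf:
  assumes ac: "acyclic_edges F" and fin: "finite F" and ne: "F \<noteq> {}" and simp: "simple_edges F"
  shows "\<exists>v w. {v, w} \<in> F \<and> v \<noteq> w \<and> (\<forall>e\<in>F. v \<in> e \<longrightarrow> e = {v, w})"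
proof -
  define path where "path p \<longleftrightarrow> distinct p \<and> length p \<ge> 2 \<and>
    (\<forall>i. Suc i < length p \<longrightarrow> {p ! i, p ! Suc i} \<in> F)" for p
  have finU: "finite (\<Union>F)" using fin simp by (auto simp: simple_edges_def)
  have sub: "set p \<subseteq> \<Union>F" if "path p" for p
  proof
    fix x assume "x \<in> set p"
    then obtain i where i: "i < length p" "p ! i = x" by (metis in_set_conv_nth)
    show "x \<in> \<Union>F"
    proof (cases "Suc i < length p")
      case True
      then have "{p ! i, p ! Suc i} \<in> F" using that unfolding path_def by blast
      then show ?thesis using i by blast
    next
      case False
      then have "i \<noteq> 0" "Suc (i - 1) < length p" "Suc (i - 1) = i" using that i by (auto simp: path_def)
      then have "{p ! (i - 1), p ! i} \<in> F" using that unfolding path_def by metis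
      then show ?thesis using i by blast
    qed
  qed
  have bound: "length p \<le> card (\<Union>F)" if "path p" for p
    using sub[OF that] that finU by (metis card_mono distinct_card path_def)
  obtain e0 where "e0 \<in> F" using ne by blast
  then obtain a b where "a \<noteq> b" "{a, b} \<in> F" using simp by (auto simp: simple_edges_def)
  then have "path [a, b]" by (auto simp: path_def)
  then have "\<exists>p. path p \<and> (\<forall>q. path q \<longrightarrow> length q \<le> length p)"
    using ex_has_greatest_nat[of path "[a, b]" length "Suc (card (\<Union>F))"] bound by (simp add: le_imp_less_Suc)
  then obtain p where p: "path p" and mx: "\<And>q. path q \<Longrightarrow> length q \<le> length p" by blast
  then obtain v w ps where p_eq: "p = v # w # ps"
    by (metis One_nat_def Suc_1 Suc_le_length_iff path_def)
  have vw: "{v, w} \<in> F" "v \<noteq> w" using p p_eq by (auto simp: path_def)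
  have "e = {v, w}" if e: "e \<in> F" "v \<in> e" for e
  proof (rule ccontr)
    assume ne: "e \<noteq> {v, w}"
    obtain x where x: "e = {v, x}" "x \<noteq> v" using simp e unfolding simple_edges_def by fastforce
    show False
    proof (cases "x \<in> set p")
      case False
      have "path (x # p)" using p False x e unfolding path_def
        by (auto simp: nth_Cons p_eq insert_commute split: nat.split)
      then show False using mx by force
    next
      case True
      then obtain j where j: "j < length p" "p ! j = x" by (metis in_set_conv_nth)
      \<comment> \<open>Index 0 is \<open>v\<close> itself and index 1 is \<open>w\<close>, the end
        of the known edge; from index 2 on, the closed prefix has the three vertices that
        \<open>is_cycle\<close> demands.\<close>
      have "j \<noteq> 0" "j \<noteq> 1" using j x ne p_eq by auto
      then have j2: "j \<ge> 2" by simp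
      have "is_cycle F (take (Suc j) p)"
        unfolding is_cycle_def
      proof (intro conjI allI impI)
        show "3 \<le> length (take (Suc j) p)" using j j2 by simp
        show "distinct (take (Suc j) p)" using p by (simp add: path_def)
        fix i assume i: "i < length (take (Suc j) p)"
        show "{take (Suc j) p ! i, take (Suc j) p ! (Suc i mod length (take (Suc j) p))} \<in> F"
        proof (cases "i = j")
          case True
          have "{x, p ! 0} \<in> F" using e x p_eq by (simp add: insert_commute)
          then show ?thesis using True j j2 by simp
        next
          case False
          then show ?thesis using i j p by (auto simp: path_def)
        qed
      qed
      then show False using ac by (auto simp: acyclic_edges_def)
    qed
  qed
  then show ?thesis using vw by blast
qed

text \<open>Rooting the trees: a leaf takes its neighbor as parent, and no remaining edge contains
  the leaf, so redefining \<open>h\<close> there disturbs nothing. One function per forest bounds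
  the out-degree by the number of forests.\<close>

lemma forest_parent:
  assumes "finite F" "acyclic_edges F" "simple_edges F"
  shows "\<exists>h :: nat \<Rightarrow> nat. \<forall>e\<in>F. \<exists>v. e = {v, h v}"
  using assms
proof (induction "card F" arbitrary: F)
  case 0
  then show ?case by auto
next
  case (Suc n)
  then have "F \<noteq> {}" by auto
  then obtain v w where vw: "{v, w} \<in> F" "v \<noteq> w" "\<And>e. e \<in> F \<Longrightarrow> v \<in> e \<Longrightarrow> e = {v, w}"
    using forest_has_leaf Suc by meson
  let ?F = "F - {{v, w}}"
  have "simple_edges ?F" "acyclic_edges ?F"
    using Suc.prems acyclic_edges_mono[of F ?F] by (auto simp: simple_edges_def)
  moreover have "n = card ?F" using Suc.hyps(2) vw(1) by simp
  ultimately obtain h where h: "\<forall>e\<in>?F. \<exists>x. e = {x, h x}" using Suc.hyps(1)[of ?F] Suc.prems(1)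
    by auto
  have parent: "\<exists>x. e = {x, (h(v := w)) x}" if "e \<in> F" for e
  proof (cases "e = {v, w}")
    case True then show ?thesis by (intro exI[of _ v]) simp
  next
    case False
    then have "e \<in> ?F" using that by simp
    then obtain x where x: "e = {x, h x}" using h by metis
    then have "v \<notin> e" "x \<in> e" using vw(3)[OF that] False by (blast, simp)
    then have "x \<noteq> v" by metis
    then have "e = {x, (h(v := w)) x}" using x by (metis fun_upd_other)
    then show ?thesis ..
  qed
  show ?case by (intro exI[of _ "h(v := w)"] ballI parent)
qed

section \<open>Forest decompositions and arboricity\<close>

text \<open>The condition minimized in \<open>arboricity\<close>, for bare edge sets so that it
  applies to subsets of the edges as well.\<close>

definition forest_decomposable :: "nat \<Rightarrow> nat set set \<Rightarrow> bool" where
  "forest_decomposable k E \<longleftrightarrow> (\<exists>F :: nat \<Rightarrow> nat set set.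
     (\<forall>i<k. F i \<subseteq> E \<and> acyclic_edges (F i)) \<and> (\<Union>i<k. F i) = E)"

lemma arboricity_Least: "arboricity G = (LEAST k. forest_decomposable k (edges G))"
  unfolding arboricity_def forest_decomposable_def ..

lemma forest_decomposable_mono:
  assumes "forest_decomposable k E" "E' \<subseteq> E" "k \<le> k'"
  shows "forest_decomposable k' E'"
proof -
  obtain F where F: "\<forall>i<k. F i \<subseteq> E \<and> acyclic_edges (F i)" "(\<Union>i<k. F i) = E"
    using assms by (auto simp: forest_decomposable_def)
  let ?F = "\<lambda>i. if i < k then F i \<inter> E' else {}"
  have "(\<Union>i<k'. ?F i) = E'" using F assms(2,3) by (fastforce split: if_splits)
  moreover have "\<forall>i<k'. ?F i \<subseteq> E' \<and> acyclic_edges (?F i)"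
    using F acyclic_edges_mono acyclic_edges_empty by (metis Int_lower1 Int_lower2 empty_subsetI)
  ultimately show ?thesis unfolding forest_decomposable_def by (intro exI[of _ ?F]) blast
qed

text \<open>The at most \<open>k\<close> edges of the star go to different forests, and in each of
  them the new vertex \<open>v\<close> is a leaf.\<close>

lemma forest_decomposable_Un_star:
  assumes dec: "forest_decomposable k E" and v: "v \<notin> \<Union>E" and W: "finite W" "card W \<le> k"
  shows "forest_decomposable k (E \<union> (\<lambda>w. {v, w}) ` W)"
proof -
  obtain F where F: "\<forall>i<k. F i \<subseteq> E \<and> acyclic_edges (F i)" "(\<Union>i<k. F i) = E"
    using dec by (auto simp: forest_decomposable_def)
  obtain g where g: "bij_betw g {0..<card W} W" using W ex_bij_betw_nat_finite by blast
  let ?F = "\<lambda>i. if i < card W then insert {v, g i} (F i) else F i"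
  have gW: "g ` {0..<card W} = W" using g by (simp add: bij_betw_def)
  have forests: "?F i \<subseteq> E \<union> (\<lambda>w. {v, w}) ` W \<and> acyclic_edges (?F i)" if "i < k" for i
  proof
    show "?F i \<subseteq> E \<union> (\<lambda>w. {v, w}) ` W" 
    proof (cases "i < card W")
      case True
      then have "g i \<in> W" using gW by force
      then show ?thesis using F that by auto
    qed (use F that in auto)
    show "acyclic_edges (?F i)" using F that v by (auto intro!: acyclic_edges_insert)
  qed
  have "(\<Union>i<k. ?F i) = E \<union> (\<lambda>w. {v, w}) ` W"
  proof
    show "(\<Union>i<k. ?F i) \<subseteq> E \<union> (\<lambda>w. {v, w}) ` W"
      by (intro UN_least conjunct1[OF forests]) simp
    have "{v, w} \<in> (\<Union>i<k. ?F i)" if "w \<in> W" for w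
    proof -
      have "w \<in> g ` {0..<card W}" unfolding gW by (rule that)
      then obtain i where "i < card W" "w = g i" by (meson atLeastLessThan_iff imageE)
      then have "{v, w} \<in> ?F i" "i \<in> {..<k}" using W by simp_all
      then show ?thesis by (rule UN_I[rotated])
    qed
    moreover have "E \<subseteq> (\<Union>i<k. ?F i)" using F(2) by force
    ultimately show "E \<union> (\<lambda>w. {v, w}) ` W \<subseteq> (\<Union>i<k. ?F i)" by blast
  qed
  then show ?thesis unfolding forest_decomposable_def
    by (intro exI[of _ ?F] conjI[of "\<forall>i<k. _ i"] allI impI forests)
qed

lemma forest_decomposable_disjoint_Un:
  assumes "forest_decomposable k A" "forest_decomposable k B" "\<Union>A \<inter> \<Union>B = {}"
  shows "forest_decomposable k (A \<union> B)"
proof -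
  obtain F where F: "\<forall>i<k. F i \<subseteq> A \<and> acyclic_edges (F i)" "(\<Union>i<k. F i) = A"
    using assms by (auto simp: forest_decomposable_def)
  obtain F' where F': "\<forall>i<k. F' i \<subseteq> B \<and> acyclic_edges (F' i)" "(\<Union>i<k. F' i) = B"
    using assms by (auto simp: forest_decomposable_def)
  have "acyclic_edges (F i \<union> F' i)" if "i < k" for i
    using that F F' assms(3) by (intro acyclic_edges_disjoint_Un) blast+
  then show ?thesis using F F' unfolding forest_decomposable_def
    by (intro exI[of _ "\<lambda>i. F i \<union> F' i"]) blast
qed

text \<open>One forest per edge; hence the minimum defining \<open>arboricity\<close> is
  attained.\<close>

lemma forest_decomposable_card:
  assumes "finite E" "simple_edges E"
  shows "forest_decomposable (card E) E"
proof -
  obtain g where g: "bij_betw g {0..<card E} E" using assms ex_bij_betw_nat_finite by blast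
  then have gE: "g ` {..<card E} = E" by (simp add: bij_betw_def atLeast0LessThan)
  have "acyclic_edges {e}" if "e \<in> E" for e
    using assms that acyclic_edges_insert[OF acyclic_edges_empty] by (auto simp: simple_edges_def)
  then show ?thesis using gE unfolding forest_decomposable_def
    by (intro exI[of _ "\<lambda>i. {g i}"]) blast
qed

lemma forest_decomposable_arboricity:
  assumes "finite (edges G)" "simple_edges (edges G)"
  shows "forest_decomposable (arboricity G) (edges G)"
  unfolding arboricity_Least using LeastI forest_decomposable_card[OF assms] by metis

lemma arboricity_le_iff:
  assumes "finite (edges G)" "simple_edges (edges G)"
  shows "arboricity G \<le> k \<longleftrightarrow> forest_decomposable k (edges G)"
  using forest_decomposable_arboricity[OF assms] forest_decomposable_mono
  by (metis Least_le arboricity_Least order_refl)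

lemma simple_graph_edges:
  assumes "simple_graph G"
  shows "finite (edges G)" "simple_edges (edges G)" "\<Union>(edges G) \<subseteq> verts G"
proof -
  have "edges G \<subseteq> Pow (verts G)" using assms by (auto simp: simple_graph_def)
  then show "finite (edges G)" using assms by (meson finite_Pow_iff finite_subset simple_graph_def)
  show "simple_edges (edges G)" using assms unfolding simple_graph_def simple_edges_def by blast
  show "\<Union>(edges G) \<subseteq> verts G" using \<open>edges G \<subseteq> Pow (verts G)\<close> by blast
qed

section \<open>Critical subgraphs and the dense core\<close>

text \<open>A non-decomposable subset of least cardinality works. A vertex of degree at most
  \<open>k\<close> could be removed, the rest decomposed by minimality and its star put back; two
  parts without a common vertex could be decomposed separately and merged.\<close>

lemma critical_subgraph:
  assumes fin: "finite E" and simp: "simple_edges E" and ndec: "\<not> forest_decomposable k E"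
  obtains E' where "E' \<subseteq> E" "\<not> forest_decomposable k E'"
    "\<And>v. v \<in> \<Union>E' \<Longrightarrow> k < card {w. {v, w} \<in> E'}"
    "\<And>A. A \<subseteq> E' \<Longrightarrow> \<Union>A \<inter> \<Union>(E' - A) = {} \<Longrightarrow> A = {} \<or> A = E'"
proof -
  define P where "P E' \<longleftrightarrow> E' \<subseteq> E \<and> \<not> forest_decomposable k E'" for E'
  have "P E" using ndec by (simp add: P_def)
  then obtain E' where E': "P E'" and mn: "\<And>A. P A \<Longrightarrow> card E' \<le> card A"
    using ex_has_least_nat[of P E card] by blast
  have finE': "finite E'" using E' fin finite_subset by (auto simp: P_def)
  have min: "forest_decomposable k A" if "A \<subset> E'" for A
    using mn[of A] psubset_card_mono[OF finE' that] that E' by (force simp: P_def)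
  have deg: "k < card {w. {v, w} \<in> E'}" if v: "v \<in> \<Union>E'" for v
  proof (rule ccontr)
    assume "\<not> k < card {w. {v, w} \<in> E'}"
    then have small: "card {w. {v, w} \<in> E'} \<le> k" by simp
    let ?A = "{e \<in> E'. v \<notin> e}"
    have "{w. {v, w} \<in> E'} \<subseteq> \<Union>E'" by blast
    moreover have "finite e" if "e \<in> E'" for e
      using that simp E' by (auto simp: simple_edges_def P_def)
    then have "finite (\<Union>E')" using finE' by blast
    ultimately have "finite {w. {v, w} \<in> E'}" by (rule finite_subset)
    then have "forest_decomposable k (?A \<union> (\<lambda>w. {v, w}) ` {w. {v, w} \<in> E'})"
      using v small by (intro forest_decomposable_Un_star min) auto
    moreover have "?A \<union> (\<lambda>w. {v, w}) ` {w. {v, w} \<in> E'} = E'"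
    proof -
      have "e \<in> (\<lambda>w. {v, w}) ` {w. {v, w} \<in> E'}" if "e \<in> E'" "v \<in> e" for e
      proof -
        have "e \<in> E" using that E' by (auto simp: P_def)
        then obtain a b where "e = {a, b}" using simp by (auto simp: simple_edges_def)
        then have "e = {v, if v = a then b else a}" using that by auto
        then show ?thesis using that by blast
      qed
      then show ?thesis by blast
    qed
    ultimately show False using E' by (simp add: P_def)
  qed
  have conn: "A = {} \<or> A = E'" if "A \<subseteq> E'" "\<Union>A \<inter> \<Union>(E' - A) = {}" for A
  proof (rule ccontr)
    assume "\<not> (A = {} \<or> A = E')"
    then have "A \<subset> E'" "E' - A \<subset> E'" using that by blast+
    then have "forest_decomposable k (A \<union> (E' - A))"
      using that by (intro forest_decomposable_disjoint_Un min)
    moreover have "A \<union> (E' - A) = E'" using that by blast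
    ultimately show False using E' by (simp add: P_def)
  qed
  show ?thesis using that[of E'] E' deg conn by (simp add: P_def)
qed

text \<open>The edges that meet the set reachable from \<open>u\<close> share no vertex with the
  other edges, so by inseparability they are all of \<open>E\<close>.\<close>

lemma inseparable_imp_connected:
  assumes simp: "simple_edges E"
    and insep: "\<And>A. A \<subseteq> E \<Longrightarrow> \<Union>A \<inter> \<Union>(E - A) = {} \<Longrightarrow> A = {} \<or> A = E"
    and uv: "u \<in> \<Union>E" "v \<in> \<Union>E"
  shows "(u, v) \<in> {(x, y). {x, y} \<in> E}\<^sup>*"
proof -
  let ?R = "{(x, y). {x, y} \<in> E}"
  define A where "A = {e \<in> E. \<exists>x\<in>e. (u, x) \<in> ?R\<^sup>*}"
  have reach: "(u, y) \<in> ?R\<^sup>*" if y: "e \<in> A" "y \<in> e" for e y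
  proof -
    obtain x where x: "e \<in> E" "x \<in> e" "(u, x) \<in> ?R\<^sup>*"
      using y unfolding A_def by blast
    show ?thesis
    proof (cases "y = x")
      case False
      then have "e = {x, y}" using simp x y unfolding simple_edges_def by fastforce
      then have "(x, y) \<in> ?R" using x by simp
      then show ?thesis using x by (meson rtrancl.rtrancl_into_rtrancl)
    qed (use x in simp)
  qed
  have "\<Union>A \<inter> \<Union>(E - A) = {}" using reach by (auto simp: A_def)
  moreover have "A \<noteq> {}" using uv by (auto simp: A_def)
  ultimately have "A = E" using insep[of A] by (auto simp: A_def)
  then show ?thesis using uv reach by blast
qed

text \<open>Each pendant edge is a star of size one centered at its new leaf, so a single forest
  absorbs it; this is where \<open>1 \<le> k\<close> enters.\<close>

lemma forest_decomposable_pendants: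
  assumes "forest_decomposable k E" "1 \<le> k" "finite W" "W \<inter> \<Union>E = {}" "u \<notin> W"
  shows "forest_decomposable k (E \<union> (\<lambda>w. {u, w}) ` W)"
  using assms(3,1,2,4,5)
proof (induction W)
  case empty
  then show ?case by simp
next
  case (insert w W)
  have "forest_decomposable k ((E \<union> (\<lambda>w. {u, w}) ` W) \<union> (\<lambda>x. {w, x}) ` {u})"
    using insert by (intro forest_decomposable_Un_star[of k "E \<union> (\<lambda>w. {u, w}) ` W" w "{u}"]) auto
  then show ?case by (simp add: insert_commute Un_commute)
qed

text \<open>The family fixes arboricity and maximum degree exactly, while the degrees of the core
  may all stay below \<open>\<Delta>\<close>. Leaves at \<open>u\<close> raise the degree there to
  \<open>\<Delta>\<close>, the other core degrees are bounded by those in \<open>G\<close>, and the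
  arboricity stays \<open>\<alpha>\<close>: pendant edges fit into the forests, and the core already
  excludes \<open>\<alpha> - 1\<close> forests.\<close>

lemma dense_core_graph:
  fixes G :: graph
  assumes G: "connected_graph G" and \<alpha>: "arboricity G = \<alpha>" and \<Delta>: "max_degree G = \<Delta>" "1 \<le> \<Delta>"
  obtains H :: graph and E u where
    "connected_graph H" "arboricity H = \<alpha>" "max_degree H = \<Delta>" "1 \<le> \<alpha>"
    "E \<subseteq> edges H" "E \<noteq> {}" "\<And>v. v \<in> \<Union>E \<Longrightarrow> \<alpha> \<le> card {w. {v, w} \<in> E}"
    "\<And>v w. v \<in> \<Union>E \<Longrightarrow> v \<noteq> u \<Longrightarrow> {v, w} \<in> edges H \<Longrightarrow> {v, w} \<in> E"
proof -
  have sg: "simple_graph G" using G by (simp add: connected_graph_def)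
  have finG: "finite (verts G)" and neG: "verts G \<noteq> {}"
    using G by (auto simp: connected_graph_def simple_graph_def)
  note e = simple_graph_edges[OF sg]
  have degG: "degree G v \<le> \<Delta>" if "v \<in> verts G" for v
    using that finG \<Delta> by (auto simp: max_degree_def)
  \<comment> \<open>Without edges all degrees vanish, against \<open>1 \<le> \<Delta>\<close>; from
    here on \<open>\<alpha> - 1\<close> is a true predecessor.\<close>
  have "\<alpha> \<noteq> 0"
  proof
    assume "\<alpha> = 0"
    then have "edges G = {}" using forest_decomposable_arboricity[OF e(1,2)] \<alpha>
      by (auto simp: forest_decomposable_def)
    then have "degree G ` verts G = {0}" using neG by (auto simp: degree_def neighbors_def)
    then show False using \<Delta> by (simp add: max_degree_def)
  qed
  then have nd: "\<not> forest_decomposable (\<alpha> - 1) (edges G)"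
    using arboricity_le_iff[OF e(1,2), of "\<alpha> - 1"] \<alpha> by linarith
  obtain E where E: "E \<subseteq> edges G" "\<not> forest_decomposable (\<alpha> - 1) E"
      and deg: "\<And>v. v \<in> \<Union>E \<Longrightarrow> \<alpha> - 1 < card {w. {v, w} \<in> E}"
      and insep: "\<And>A. A \<subseteq> E \<Longrightarrow> \<Union>A \<inter> \<Union>(E - A) = {} \<Longrightarrow> A = {} \<or> A = E"
    using critical_subgraph[OF e(1,2) nd] by metis
  have finE: "finite E" using E e finite_subset by blast
  have simpE: "simple_edges E" using E e by (auto simp: simple_edges_def)
  have UE: "\<Union>E \<subseteq> verts G" using E e by blast
  have finUE: "finite (\<Union>E)" using UE finG finite_subset by blast
  have neE: "E \<noteq> {}" using E(2) by (auto simp: forest_decomposable_def acyclic_edges_empty)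
  then obtain u where u: "u \<in> \<Union>E" using simpE by (fastforce simp: simple_edges_def)
  let ?d = "card {w. {u, w} \<in> E}"
  have finN: "finite {w. {v, w} \<in> edges G}" for v
    by (rule finite_subset[OF _ finG]) (use e in auto)
  have degE: "card {w. {v, w} \<in> E} \<le> \<Delta>" if "v \<in> \<Union>E" for v
  proof -
    have "card {w. {v, w} \<in> E} \<le> card {w. {v, w} \<in> edges G}"
      using E finN by (intro card_mono) auto
    then show ?thesis using degG[of v] that UE by (auto simp: degree_def neighbors_def)
  qed
  obtain W where W: "W \<subseteq> - \<Union>E" "finite W" "card W = \<Delta> - ?d"
    using finUE infinite_arbitrarily_large[of "- \<Union>E" "\<Delta> - ?d"]
    by (metis Compl_eq_Diff_UNIV Diff_infinite_finite infinite_UNIV_nat)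
  have uW: "u \<notin> W" using u W by blast
  define H :: graph where "H = \<lparr>verts = \<Union>E \<union> W, edges = E \<union> (\<lambda>w. {u, w}) ` W\<rparr>"
  have sH: "simple_graph H"
    unfolding simple_graph_def
  proof (intro conjI ballI)
    show "finite (verts H)" using finUE W by (simp add: H_def)
    fix f assume "f \<in> edges H"
    then consider "f \<in> E" | w where "w \<in> W" "f = {u, w}" by (auto simp: H_def)
    then show "\<exists>a\<in>verts H. \<exists>b\<in>verts H. a \<noteq> b \<and> f = {a, b}"
    proof cases
      case 1
      then obtain a b where ab: "a \<noteq> b" "f = {a, b}" using simpE by (auto simp: simple_edges_def)
      then have "a \<in> \<Union>E" "b \<in> \<Union>E" using 1 by blast+
      then show ?thesis using ab by (auto simp: H_def)
    next
      case 2
      then show ?thesis using u uW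
        by (intro bexI[of _ u] bexI[of _ w]) (auto simp: H_def)
    qed
  qed
  let ?R = "{(x, y). {x, y} \<in> edges H}"
  have sym: "(x, y) \<in> ?R\<^sup>*" if "(y, x) \<in> ?R\<^sup>*" for x y
  proof -
    have "sym ?R" by (auto simp: sym_def insert_commute)
    then show ?thesis using that sym_rtrancl[of ?R] by (meson symE)
  qed
  have to_u: "(u, v) \<in> ?R\<^sup>*" if "v \<in> verts H" for v
  proof (cases "v \<in> W")
    case True
    then have "(u, v) \<in> ?R" by (simp add: H_def)
    then show ?thesis by blast
  next
    case False
    then have "(u, v) \<in> {(x, y). {x, y} \<in> E}\<^sup>*"
      using that by (intro inseparable_imp_connected[OF simpE insep u]) (auto simp: H_def)
    moreover have "{(x, y). {x, y} \<in> E} \<subseteq> ?R" by (auto simp: H_def)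
    ultimately show ?thesis using rtrancl_mono by blast
  qed
  have cH: "connected_graph H"
    unfolding connected_graph_def
  proof (intro conjI ballI)
    show "verts H \<noteq> {}" using u by (auto simp: H_def)
    fix x y assume "x \<in> verts H" "y \<in> verts H"
    then show "(x, y) \<in> ?R\<^sup>*" using to_u sym by (meson rtrancl_trans)
  qed (rule sH)
  note eH = simple_graph_edges[OF sH]
  have "forest_decomposable \<alpha> E"
    using forest_decomposable_arboricity[OF e(1,2)] E(1) \<alpha> forest_decomposable_mono by blast
  then have "forest_decomposable \<alpha> (edges H)"
    using \<open>\<alpha> \<noteq> 0\<close> W uW by (auto simp: H_def intro!: forest_decomposable_pendants)
  then have "arboricity H \<le> \<alpha>" using arboricity_le_iff[OF eH(1,2)] by blast
  moreover have "\<not> forest_decomposable (\<alpha> - 1) (edges H)"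
    using E(2) forest_decomposable_mono[of "\<alpha> - 1" "edges H" E] by (auto simp: H_def)
  then have "\<not> arboricity H \<le> \<alpha> - 1" using arboricity_le_iff[OF eH(1,2)] by blast
  ultimately have arb: "arboricity H = \<alpha>" by linarith
  have nbr_u: "neighbors H u = {w. {u, w} \<in> E} \<union> W"
    using uW by (auto simp: neighbors_def H_def doubleton_eq_iff)
  have nbr: "{v, w} \<in> E" if "v \<in> \<Union>E" "v \<noteq> u" "{v, w} \<in> edges H" for v w
    using that W by (auto simp: H_def doubleton_eq_iff)
  have deg_u: "degree H u = \<Delta>"
  proof -
    have "finite {w. {u, w} \<in> E}" by (rule finite_subset[OF _ finUE]) auto
    moreover have "{w. {u, w} \<in> E} \<inter> W = {}" using W by auto
    ultimately have "degree H u = ?d + (\<Delta> - ?d)"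
      unfolding degree_def nbr_u using W by (simp add: card_Un_disjoint)
    then show ?thesis using degE[OF u] by simp
  qed
  have degH: "degree H v \<le> \<Delta>" if v: "v \<in> verts H" for v
  proof (cases "v = u")
    case False
    show ?thesis
    proof (cases "v \<in> W")
      case True
      have "neighbors H v \<subseteq> {u}" using True W False by (auto simp: neighbors_def H_def doubleton_eq_iff)
      then have "degree H v \<le> 1" unfolding degree_def by (metis card.empty card_insert_le_m1 card_mono finite.emptyI finite_insert is_singletonI is_singleton_altdef)
      then show ?thesis using \<Delta> by simp
    next
      case nW: False
      then have vE: "v \<in> \<Union>E" using v by (simp add: H_def)
      have "neighbors H v = {w. {v, w} \<in> E}"
        using nbr[OF vE False] by (auto simp: neighbors_def H_def)
      then show ?thesis using degE[OF vE] by (simp add: degree_def)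
    qed
  qed (simp add: deg_u)
  have "max_degree H = \<Delta>"
    unfolding max_degree_def
  proof (rule Max_eqI)
    show "finite (degree H ` verts H)" using sH by (simp add: simple_graph_def)
    show "\<Delta> \<in> degree H ` verts H" using deg_u u by (force simp: H_def)
  qed (use degH in auto)
  then show ?thesis
  proof (rule that[OF cH arb])
    show "1 \<le> \<alpha>" using \<open>\<alpha> \<noteq> 0\<close> by simp
    show "E \<subseteq> edges H" by (simp add: H_def)
    show "\<alpha> \<le> card {w. {v, w} \<in> E}" if "v \<in> \<Union>E" for v using deg[OF that] by simp
  qed (fact neE nbr)+
qed

section \<open>Counting bit strings and multicast patterns\<close>

text \<open>Messages may have any length up to \<open>k\<close>, hence the exponent
  \<open>k + 1\<close> that reappears in the lower bound.\<close>

lemma finite_bits_le: "finite {l :: bits. length l \<le> k}"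
  and card_bits_le: "card {l :: bits. length l \<le> k} \<le> 2 ^ (k + 1)"
proof -
  have *: "{l :: bits. length l \<le> k} = {l. set l \<subseteq> UNIV \<and> length l \<le> k}" by simp
  show "finite {l :: bits. length l \<le> k}" unfolding * by (rule finite_lists_length_le) simp
  have "(\<Sum>i\<le>k. (2::nat) ^ i) \<le> 2 ^ (k + 1)" by (induction k) auto
  then show "card {l :: bits. length l \<le> k} \<le> 2 ^ (k + 1)"
    unfolding * by (subst card_lists_length_le) auto
qed

lemma finite_bits_eq: "finite {l :: bits. length l = b}"
  and card_bits_eq: "card {l :: bits. length l = b} = 2 ^ b"
proof -
  have *: "{l :: bits. length l = b} = {l. set l \<subseteq> UNIV \<and> length l = b}" by simp
  show "finite {l :: bits. length l = b}" unfolding * by (rule finite_lists_length_eq) simp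
  show "card {l :: bits. length l = b} = 2 ^ b"
    unfolding * by (subst card_lists_length_eq) auto
qed

text \<open>\<open>A\<close> is a set of arcs and \<open>T\<close> a set of messages. A pattern is
  recovered from a group number below \<open>r\<close> for each arc and a table of \<open>r\<close>
  messages for each vertex; the two factors count these choices.\<close>

lemma card_multicast_functions:
  assumes V: "finite V" and T: "finite T" "T \<noteq> {}" and A: "finite A" "fst ` A \<subseteq> V"
  shows "card {M \<in> A \<rightarrow>\<^sub>E T. \<forall>x\<in>V. card ((\<lambda>y. M (x, y)) ` {y. (x, y) \<in> A}) \<le> r}
    \<le> r ^ card A * card T ^ (card V * r)" (is "card ?X \<le> _")
proof -
  let ?G = "A \<rightarrow>\<^sub>E {..<r}" and ?W = "(V \<times> {..<r}) \<rightarrow>\<^sub>E T"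
  let ?f = "\<lambda>(g, w). \<lambda>p\<in>A. w (fst p, g p)"
  obtain t where t: "t \<in> T" using T by blast
  have "M \<in> ?f ` (?G \<times> ?W)" if M: "M \<in> ?X" for M
  proof -
    define I where "I x = (\<lambda>y. M (x, y)) ` {y. (x, y) \<in> A}" for x
    have finI: "finite (I x)" for x
      unfolding I_def by (rule finite_imageI, rule finite_subset[of _ "snd ` A"]) (use A in force)+
    have "\<exists>h. h ` I x \<subseteq> {..<r} \<and> inj_on h (I x)" if "x \<in> V" for x
      using M that by (intro card_le_inj finI) (auto simp: I_def)
    then obtain h where h: "\<And>x. x \<in> V \<Longrightarrow> h x ` I x \<subseteq> {..<r}" "\<And>x. x \<in> V \<Longrightarrow> inj_on (h x) (I x)"
      by metis
    have IT: "I x \<subseteq> T" for x using M by (auto simp: I_def)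
    have memI: "M p \<in> I (fst p)" "fst p \<in> V" if "p \<in> A" for p
      using that A by (cases p; force simp: I_def)+
    define g where "g = (\<lambda>p\<in>A. h (fst p) (M p))"
    \<comment> \<open>The table inverts the numbering \<open>h x\<close> of the messages of
      \<open>x\<close>; \<open>t\<close> fills the slots that no message uses.\<close>
    define w where "w = (\<lambda>q\<in>V \<times> {..<r}. if snd q \<in> h (fst q) ` I (fst q)
      then inv_into (I (fst q)) (h (fst q)) (snd q) else t)"
    have "g \<in> ?G" using h memI by (fastforce simp: g_def)
    moreover have "w \<in> ?W" unfolding w_def
    proof (rule restrict_PiE_iff[THEN iffD2], rule ballI)
      fix q assume "q \<in> V \<times> {..<r}"
      show "(if snd q \<in> h (fst q) ` I (fst q) then inv_into (I (fst q)) (h (fst q)) (snd q) else t) \<in> T"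
        using t IT by (meson in_mono inv_into_into)
    qed
    moreover have "M = ?f (g, w)"
    proof
      fix p
      show "M p = ?f (g, w) p"
      proof (cases "p \<in> A")
        case True
        note m = memI[OF True]
        have "(fst p, g p) \<in> V \<times> {..<r}" using h(1)[OF m(2)] m True by (auto simp: g_def)
        then show ?thesis using True m h(2)[OF m(2)] by (simp add: w_def g_def)
      next
        case False
        then show ?thesis using M by auto
      qed
    qed
    ultimately show ?thesis by (intro image_eqI[of _ _ "(g, w)"]) auto
  qed
  moreover have fin: "finite (?G \<times> ?W)" using assms by (intro finite_cartesian_product finite_PiE) auto
  ultimately have "card ?X \<le> card (?G \<times> ?W)"
    by (meson card_image_le card_mono finite_imageI le_trans subsetI)
  also have "\<dots> = r ^ card A * card T ^ (card V * r)"
    using assms by (simp add: card_cartesian_product card_PiE)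
  finally show ?thesis .
qed

section \<open>Switching one node between legal configurations\<close>

text \<open>\<open>B v w\<close> is the string that \<open>v\<close> holds for its edge to
  \<open>w\<close>. Indexed by ordered pairs, \<open>B\<close> can also describe disagreement, and
  replacing \<open>B v\<close> changes the state of \<open>v\<close> alone.\<close>

definition ea_config ::
    "graph \<Rightarrow> (nat \<Rightarrow> nat \<Rightarrow> nat) \<Rightarrow> (nat \<Rightarrow> nat \<Rightarrow> bits) \<Rightarrow> 'x ea_state_scheme config" where
  "ea_config H p B = \<lparr>verts = verts H, edges = edges H, port = p,
     state = \<lambda>v. \<lparr>ident = v,
       strings = map (\<lambda>i. B v (inv_into (neighbors H v) (p v) i)) [1..<Suc (degree H v)],
       \<dots> = undefined\<rparr>\<rparr>"

lemma neighbors_cong: "edges G = edges G' \<Longrightarrow> neighbors G v = neighbors G' v"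
  by (simp add: neighbors_def)

lemma degree_cong: "edges G = edges G' \<Longrightarrow> degree G v = degree G' v"
  unfolding degree_def using neighbors_cong by metis

lemma ea_config_simps [simp]:
  "verts (ea_config H p B) = verts H" "edges (ea_config H p B) = edges H"
  "port (ea_config H p B) = p" "ident (state (ea_config H p B) v) = v"
  "strings (state (ea_config H p B) v) =
     map (\<lambda>i. B v (inv_into (neighbors H v) (p v) i)) [1..<Suc (degree H v)]"
  "neighbors (ea_config H p B) v = neighbors H v" "degree (ea_config H p B) v = degree H v"
  by (auto simp: ea_config_def intro!: neighbors_cong degree_cong)

lemma ea_config_state_cong:
  "B v = B' v \<Longrightarrow> state (ea_config H p B) v = state (ea_config H p B') v"
  by (simp add: ea_config_def)

lemma ea_config_neighbor_at [simp]:
  "neighbor_at (ea_config H p B) v i = inv_into (neighbors H v) (p v) i"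
  by (simp add: neighbor_at_def)

lemma ea_config_in_EA_family:
  assumes H: "connected_graph H" and p: "\<And>v. v \<in> verts H \<Longrightarrow> bij_betw (p v) (neighbors H v) {1..degree H v}"
    and B: "\<And>v w. length (B v w) = b"
  shows "ea_config H p B \<in> restrict_family (arboricity H) (max_degree H) (EA_family b)"
proof -
  have "connected_graph (ea_config H p B)"
    using H by (simp add: connected_graph_def simple_graph_def)
  moreover have "arboricity (ea_config H p B) = arboricity H" by (simp add: arboricity_def)
  moreover have "max_degree (ea_config H p B) = max_degree H"
    by (simp add: max_degree_def)
  ultimately show ?thesis using p B
    by (auto simp: restrict_family_def EA_family_def configuration_def)
qed

lemma ea_config_edge_string:
  assumes p: "bij_betw (p v) (neighbors H v) {1..degree H v}" and w: "{v, w} \<in> edges H"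
  shows "edge_string (ea_config H p B) v w = B v w"
proof -
  have wn: "w \<in> neighbors H v" using w by (simp add: neighbors_def)
  then have "p v w \<in> {1..degree H v}" using p bij_betwE by blast
  moreover have "inv_into (neighbors H v) (p v) (p v w) = w"
    using p wn by (simp add: bij_betw_def)
  ultimately show ?thesis
    by (auto simp: edge_string_def nth_append simp del: upt_Suc)
qed

text \<open>A single node may switch to the state and label that it has in another accepted
  configuration, as long as no message on an incident edge reveals the switch.\<close>

lemma accepted_switch_node:
  fixes S :: "'x ea_state_scheme pls" and B\<^sub>1 B\<^sub>2 :: "nat \<Rightarrow> nat \<Rightarrow> bits" and H p
  defines "C\<^sub>1 \<equiv> ea_config H p B\<^sub>1" and "C\<^sub>2 \<equiv> ea_config H p B\<^sub>2"
  assumes H: "simple_graph H" and p: "\<And>v. v \<in> verts H \<Longrightarrow> bij_betw (p v) (neighbors H v) {1..degree H v}"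
    and acc: "accepted S C\<^sub>1 l\<^sub>1" "accepted S C\<^sub>2 l\<^sub>2"
    and out: "\<And>w. {v, w} \<in> edges H \<Longrightarrow> message S C\<^sub>1 l\<^sub>1 v (p v w) = message S C\<^sub>2 l\<^sub>2 v (p v w)"
    and inc: "\<And>w. {v, w} \<in> edges H \<Longrightarrow> message S C\<^sub>1 l\<^sub>1 w (p w v) = message S C\<^sub>2 l\<^sub>2 w (p w v)"
  shows "accepted S (ea_config H p (B\<^sub>1(v := B\<^sub>2 v))) (l\<^sub>1(v := l\<^sub>2 v))"
    (is "accepted S ?C ?l")
  unfolding accepted_def
proof
  fix x assume x: "x \<in> verts ?C"
  have st: "state ?C y = state (if y = v then C\<^sub>2 else C\<^sub>1) y" for y
    unfolding C\<^sub>1_def C\<^sub>2_def by (cases "y = v") (auto intro: ea_config_state_cong)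
  have msg: "message S ?C ?l y i = (if y = v then message S C\<^sub>2 l\<^sub>2 y i else message S C\<^sub>1 l\<^sub>1 y i)" for y i
    by (simp add: message_def st)
  have nb: "{x, inv_into (neighbors H x) (p x) i} \<in> edges H" if i: "i \<in> {1..degree H x}" for i
  proof -
    have "i \<in> p x ` neighbors H x" using p[of x] x i by (simp add: bij_betw_def)
    then have "inv_into (neighbors H x) (p x) i \<in> neighbors H x" by (rule inv_into_into)
    then show ?thesis by (simp add: neighbors_def)
  qed
  have ne: "y \<noteq> x" if "{x, y} \<in> edges H" for y
    using H that by (force simp: simple_graph_def doubleton_eq_iff)
  have "received S ?C ?l x = received S (if x = v then C\<^sub>2 else C\<^sub>1) (if x = v then l\<^sub>2 else l\<^sub>1) x"
    unfolding received_def
  proof (rule map_cong)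
    show "[1..<Suc (degree ?C x)] = [1..<Suc (degree (if x = v then C\<^sub>2 else C\<^sub>1) x)]"
      by (simp add: C\<^sub>1_def C\<^sub>2_def)
    fix i assume "i \<in> set [1..<Suc (degree (if x = v then C\<^sub>2 else C\<^sub>1) x)]"
    then have "i \<in> {1..degree H x}" by (auto simp: C\<^sub>1_def C\<^sub>2_def split: if_splits)
    note e = nb[OF this]
    define y where "y = inv_into (neighbors H x) (p x) i"
    have xy: "{x, y} \<in> edges H" "{y, x} \<in> edges H" "y \<noteq> x"
      using e ne[OF e] by (simp_all add: y_def insert_commute)
    \<comment> \<open>Only messages to or from \<open>v\<close> need care: \<open>out\<close> covers
      what the neighbors of \<open>v\<close> receive, \<open>inc\<close> what \<open>v\<close>
      receives.\<close>
    have "message S ?C ?l y (p y x) =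
      message S (if x = v then C\<^sub>2 else C\<^sub>1) (if x = v then l\<^sub>2 else l\<^sub>1) y (p y x)"
      using xy out[of x] inc[of y] by (auto simp: msg)
    then show "(let u = neighbor_at ?C x i in message S ?C ?l u (port ?C u x)) =
      (let u = neighbor_at (if x = v then C\<^sub>2 else C\<^sub>1) x i in
        message S (if x = v then C\<^sub>2 else C\<^sub>1) (if x = v then l\<^sub>2 else l\<^sub>1) u
          (port (if x = v then C\<^sub>2 else C\<^sub>1) u x))"
      unfolding Let_def C\<^sub>1_def C\<^sub>2_def y_def by (simp split: if_splits)
  qed
  then show "decide S (state ?C x) (?l x) (received S ?C ?l x)"
    using acc x by (auto simp: accepted_def st C\<^sub>1_def C\<^sub>2_def split: if_splits)
qed

text \<open>The message pattern \<open>M\<close> on the core arcs determines the assignment of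
  strings, so there are at least as many patterns as assignments. The first bound counts patterns
  with at most \<open>r\<close> messages per node; the second ignores the multicast limit and serves
  the case \<open>\<alpha> \<le> r\<close>.\<close>

lemma ea_message_counts:
  fixes S :: "'x ea_state_scheme pls" and H :: graph and b
  defines "\<F> \<equiv> restrict_family (arboricity H) (max_degree H) (EA_family b)"
  assumes H: "connected_graph H" and E: "E \<subseteq> edges H"
    and iso: "\<And>v w. v \<in> \<Union>E \<Longrightarrow> v \<noteq> u \<Longrightarrow> {v, w} \<in> edges H \<Longrightarrow> {v, w} \<in> E"
    and S: "is_pls \<F> EA S" "mcast r \<F> S" "max_message_length \<F> EA S \<le> enat k"
  shows "2 ^ (b * card E) \<le> r ^ card {(x, y). {x, y} \<in> E} * 2 ^ ((k + 1) * (card (\<Union>E) * r))"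
    and "2 ^ (b * card E) \<le> (2::nat) ^ ((k + 1) * card {(x, y). {x, y} \<in> E})"
proof -
  have sg: "simple_graph H" using H by (simp add: connected_graph_def)
  note eH = simple_graph_edges[OF sg]
  have finE: "finite E" using E eH finite_subset by blast
  have UE: "\<Union>E \<subseteq> verts H" using E eH by blast
  have finV: "finite (verts H)" using sg by (simp add: simple_graph_def)
  have finUE: "finite (\<Union>E)" using UE finV finite_subset by blast
  have finN: "finite (neighbors H v)" for v
    by (rule finite_subset[OF _ finV]) (use eH in \<open>auto simp: neighbors_def\<close>)
  have "\<exists>f. bij_betw f (neighbors H v) {1..degree H v}" for v
    by (rule finite_same_card_bij[OF finN]) (simp_all add: degree_def)
  then have "\<exists>p. \<forall>v. bij_betw (p v) (neighbors H v) {1..degree H v}" by (rule choice[OF allI])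
  then obtain p where p: "\<And>v. bij_betw (p v) (neighbors H v) {1..degree H v}" by blast
  let ?A = "{(x, y). {x, y} \<in> E}" and ?T = "{l :: bits. length l \<le> k}"
  have finA: "finite ?A"
  proof (rule finite_subset)
    show "?A \<subseteq> \<Union>E \<times> \<Union>E" by blast
  qed (use finUE in simp)
  let ?Bs = "E \<rightarrow>\<^sub>E {l :: bits. length l = b}"
  define str where "str \<beta> v w = (if {v, w} \<in> E then \<beta> {v, w} else replicate b False)"
    for \<beta> :: "nat set \<Rightarrow> bits" and v w
  define conf where "conf \<beta> = (ea_config H p (str \<beta>) :: 'x ea_state_scheme config)" for \<beta>
  define M where "M \<beta> = (\<lambda>(x, y)\<in>?A. message S (conf \<beta>) (prover S (conf \<beta>)) x (p x y))" for \<beta>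
  have len: "length (str \<beta> v w) = b" if "\<beta> \<in> ?Bs" for \<beta> v w
    using that by (auto simp: str_def)
  have inF: "conf \<beta> \<in> \<F>" if "\<beta> \<in> ?Bs" for \<beta>
    unfolding conf_def \<F>_def by (rule ea_config_in_EA_family[OF H p len[OF that]])
  have legal: "EA (conf \<beta>)" for \<beta>
  proof -
    have "edge_string (conf \<beta>) y x = edge_string (conf \<beta>) x y" if "{x, y} \<in> edges H" for x y
    proof -
      have "{y, x} \<in> edges H" using that by (simp add: insert_commute)
      then show ?thesis using that
        by (simp add: conf_def ea_config_edge_string[OF p] str_def insert_commute)
    qed
    then show ?thesis by (simp add: EA_def conf_def)
  qed
  have acc: "accepted S (conf \<beta>) (prover S (conf \<beta>))" if "\<beta> \<in> ?Bs" for \<beta>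
    using S(1) inF[OF that] legal by (auto simp: is_pls_def)
  have inj: "inj_on M ?Bs"
  proof (rule inj_onI, rule ccontr)
    fix \<beta> \<gamma> assume b: "\<beta> \<in> ?Bs" "\<gamma> \<in> ?Bs" and eq: "M \<beta> = M \<gamma>" and "\<beta> \<noteq> \<gamma>"
    then obtain e where e: "e \<in> E" "\<beta> e \<noteq> \<gamma> e" by (metis PiE_ext)
    then have "e \<in> edges H" using E by blast
    then obtain x y where "x \<noteq> y" "e = {x, y}" using eH unfolding simple_edges_def by metis
    \<comment> \<open>One endpoint of \<open>e\<close> differs from \<open>u\<close>; by
      \<open>iso\<close> all its edges lie in the core, so equality of the patterns covers every
      message it sends or receives.\<close>
    then obtain v w where vw: "e = {v, w}" "v \<noteq> u" "v \<noteq> w" by (metis insert_commute)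
    have vE: "v \<in> \<Union>E" using e vw by blast
    have msg: "message S (conf \<beta>) (prover S (conf \<beta>)) x (p x y) =
        message S (conf \<gamma>) (prover S (conf \<gamma>)) x (p x y)" if "{x, y} \<in> E" for x y
      using fun_cong[OF eq, of "(x, y)"] that by (simp add: M_def)
    let ?C = "ea_config H p ((str \<beta>)(v := str \<gamma> v)) :: 'x ea_state_scheme config"
    have "accepted S ?C ((prover S (conf \<beta>))(v := prover S (conf \<gamma>) v))"
    proof (rule accepted_switch_node[OF sg p])
      fix z assume "{v, z} \<in> edges H"
      then have "{v, z} \<in> E" by (rule iso[OF vE vw(2)])
      moreover from this have "{z, v} \<in> E" by (simp add: insert_commute)
      ultimately show "message S (ea_config H p (str \<beta>)) (prover S (conf \<beta>)) v (p v z) =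
          message S (ea_config H p (str \<gamma>)) (prover S (conf \<gamma>)) v (p v z)"
        "message S (ea_config H p (str \<beta>)) (prover S (conf \<beta>)) z (p z v) =
          message S (ea_config H p (str \<gamma>)) (prover S (conf \<gamma>)) z (p z v)"
        using msg by (auto simp: conf_def)
    qed (use acc b in \<open>simp_all add: conf_def\<close>)
    moreover have "?C \<in> \<F>" unfolding \<F>_def
      by (rule ea_config_in_EA_family[OF H p]) (use len b in auto)
    ultimately have "EA ?C" using S(1) by (auto simp: is_pls_def)
    have edges: "{v, w} \<in> edges H" "{w, v} \<in> edges H"
      using e vw E by (auto simp: insert_commute)
    \<comment> \<open>Node \<open>v\<close> now holds the string from \<open>\<gamma>\<close> while
      \<open>w\<close> keeps the one from \<open>\<beta>\<close>, although acceptance has forced the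
      two to agree.\<close>
    have "edge_string ?C v w = str \<gamma> v w" "edge_string ?C w v = str \<beta> w v"
      using vw(3) by (simp_all add: ea_config_edge_string[of p v H w, OF p edges(1)]
        ea_config_edge_string[of p w H v, OF p edges(2)])
    moreover have "edge_string ?C w v = edge_string ?C v w"
      using \<open>EA ?C\<close> edges(1) unfolding EA_def by simp
    ultimately have "str \<gamma> v w = str \<beta> w v" by simp
    then show False using e vw by (simp add: str_def insert_commute)
  qed
  have MT: "M \<beta> \<in> ?A \<rightarrow>\<^sub>E ?T" if b: "\<beta> \<in> ?Bs" for \<beta>
  proof (rule PiE_I)
    fix q assume q: "q \<in> ?A"
    obtain x y where xy: "q = (x, y)" "{x, y} \<in> E" using q by auto
    have "x \<in> verts H" using xy UE by blast
    moreover have "p x y \<in> {1..degree H x}"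
      using bij_betwE[OF p[of x]] xy E by (auto simp: neighbors_def)
    moreover have "conf \<beta> \<in> {C \<in> \<F>. EA C}" using inF[OF b] legal by simp
    ultimately have "enat (length (message S (conf \<beta>) (prover S (conf \<beta>)) x (p x y))) \<le> enat k"
      using S(3) unfolding max_message_length_def SUP_le_iff by (fastforce simp: conf_def)
    then show "M \<beta> q \<in> ?T" using xy by (simp add: M_def)
  qed (auto simp: M_def)
  have Mr: "card ((\<lambda>y. M \<beta> (x, y)) ` {y. (x, y) \<in> ?A}) \<le> r" if b: "\<beta> \<in> ?Bs" and x: "x \<in> \<Union>E" for \<beta> x
  proof -
    let ?m = "message S (conf \<beta>) (prover S (conf \<beta>)) x"
    have "p x y \<in> {1..degree H x}" if "{x, y} \<in> E" for y
      using bij_betwE[OF p[of x]] that E by (auto simp: neighbors_def)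
    then have "(\<lambda>y. M \<beta> (x, y)) ` {y. (x, y) \<in> ?A} \<subseteq> ?m ` {1..degree H x}"
      by (auto simp: M_def)
    then have "card ((\<lambda>y. M \<beta> (x, y)) ` {y. (x, y) \<in> ?A}) \<le> card (?m ` {1..degree H x})"
      by (intro card_mono) auto
    also have "\<dots> \<le> r"
    proof -
      have "x \<in> verts (conf \<beta>)" using x UE by (auto simp: conf_def)
      then have "card (?m ` {1..degree (conf \<beta>) x}) \<le> r"
        using S(2) inF[OF b] unfolding mcast_def by blast
      then show ?thesis by (simp add: conf_def)
    qed
    finally show ?thesis .
  qed
  have cardBs: "card ?Bs = 2 ^ (b * card E)"
    using finE by (simp add: card_PiE card_bits_eq power_mult)
  have cT: "card ?T \<le> 2 ^ (k + 1)" by (rule card_bits_le)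
  have neT: "?T \<noteq> {}" by (auto intro!: exI[of _ "[]"])
  let ?X = "{M \<in> ?A \<rightarrow>\<^sub>E ?T. \<forall>x\<in>\<Union>E. card ((\<lambda>y. M (x, y)) ` {y. (x, y) \<in> ?A}) \<le> r}"
  have "card ?Bs \<le> card ?X"
  proof (rule card_inj_on_le[OF inj])
    show "M ` ?Bs \<subseteq> ?X"
      by (intro image_subsetI CollectI conjI ballI MT Mr)
    show "finite ?X"
      by (rule finite_subset[OF _ finite_PiE[OF finA finite_bits_le]]) (rule Collect_restrict)
  qed
  also have "\<dots> \<le> r ^ card ?A * card ?T ^ (card (\<Union>E) * r)"
    by (rule card_multicast_functions[OF finUE finite_bits_le neT finA]) auto
  also have "\<dots> \<le> r ^ card ?A * (2 ^ (k + 1)) ^ (card (\<Union>E) * r)"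
    using cT by (intro mult_left_mono power_mono) auto
  also have "\<dots> = r ^ card ?A * 2 ^ ((k + 1) * (card (\<Union>E) * r))"
    by (simp only: power_mult)
  finally show "2 ^ (b * card E) \<le> r ^ card ?A * 2 ^ ((k + 1) * (card (\<Union>E) * r))"
    unfolding cardBs .
  have "card ?Bs \<le> card (?A \<rightarrow>\<^sub>E ?T)"
    by (rule card_inj_on_le[OF inj]) (use MT finite_PiE[OF finA finite_bits_le] in auto)
  also have "\<dots> = card ?T ^ card ?A" using finA by (simp add: card_PiE)
  also have "\<dots> \<le> (2 ^ (k + 1)) ^ card ?A" using cT by (intro power_mono) auto
  also have "\<dots> = 2 ^ ((k + 1) * card ?A)" by (simp only: power_mult)
  finally show "2 ^ (b * card E) \<le> (2::nat) ^ ((k + 1) * card ?A)" unfolding cardBs .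
qed

section \<open>The lower bound on the message length\<close>

text \<open>The counts are combined with \<open>\<alpha> * n \<le> a\<close> and
  \<open>a \<le> 2 * m\<close>. The factor 8 is 2 for two arcs per edge, 2 for the half of the bits
  lost to group choices and 2 for rounding up.\<close>

lemma ea_lower_bound:
  fixes S :: "'x ea_state_scheme pls" and H :: graph and b
  defines "\<F> \<equiv> restrict_family (arboricity H) (max_degree H) (EA_family b)"
  assumes H: "connected_graph H" and E: "E \<subseteq> edges H" "E \<noteq> {}"
    and iso: "\<And>v w. v \<in> \<Union>E \<Longrightarrow> v \<noteq> u \<Longrightarrow> {v, w} \<in> edges H \<Longrightarrow> {v, w} \<in> E"
    and deg: "\<And>v. v \<in> \<Union>E \<Longrightarrow> \<alpha> \<le> card {w. {v, w} \<in> E}" and \<alpha>: "1 \<le> \<alpha>"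
    and r: "1 \<le> r" "real r \<le> 2 powr (real b / 4)"
    and S: "is_pls \<F> EA S" "mcast r \<F> S" "max_message_length \<F> EA S \<le> enat k"
  shows "real_of_int \<lceil>real \<alpha> / real r\<rceil> * real b \<le> 8 * (real k + 1)"
proof -
  note counts = ea_message_counts[OF H E(1) iso S[unfolded \<F>_def]]
  let ?A = "{(x, y). {x, y} \<in> E}"
  define m n a where "m = card E" and "n = card (\<Union>E)" and "a = card ?A"
  have sg: "simple_graph H" using H by (simp add: connected_graph_def)
  note eH = simple_graph_edges[OF sg]
  have finE: "finite E" using E eH finite_subset by blast
  have simp: "\<And>e. e \<in> E \<Longrightarrow> \<exists>u v. u \<noteq> v \<and> e = {u, v}" using E eH by (auto simp: simple_edges_def)
  then have finUE: "finite (\<Union>E)" using finE by (metis finite.emptyI finite.insertI finite_Union)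
  have m: "m > 0" using E finE by (simp add: m_def card_gt_0_iff)
  have a2m: "a \<le> 2 * m"
  proof -
    have "?A = (\<Union>e\<in>E. {(x, y). {x, y} = e})" by auto
    then have "a \<le> (\<Sum>e\<in>E. card {(x, y). {x, y} = e})"
      unfolding a_def using card_UN_le[OF finE] by simp
    also have "\<dots> \<le> (\<Sum>e\<in>E. 2)"
    proof (rule sum_mono)
      fix e assume "e \<in> E"
      then obtain u v where "e = {u, v}" using simp by blast
      then have "{(x, y). {x, y} = e} \<subseteq> set [(u, v), (v, u)]" by (auto simp: doubleton_eq_iff)
      then have "card {(x, y). {x, y} = e} \<le> card (set [(u, v), (v, u)])" by (intro card_mono) auto
      also have "\<dots> \<le> 2" using card_length[of "[(u, v), (v, u)]"] by simp
      finally show "card {(x, y). {x, y} = e} \<le> 2" .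
    qed
    finally show ?thesis by (simp add: m_def)
  qed
  have an: "\<alpha> * n \<le> a"
  proof -
    have "?A = Sigma (\<Union>E) (\<lambda>v. {w. {v, w} \<in> E})" by auto
    moreover have "finite {w. {v, w} \<in> E}" for v by (rule finite_subset[OF _ finUE]) auto
    ultimately have "a = (\<Sum>v\<in>\<Union>E. card {w. {v, w} \<in> E})"
      unfolding a_def using finUE by simp
    also have "\<dots> \<ge> (\<Sum>v\<in>\<Union>E. \<alpha>)" by (rule sum_mono) (rule deg)
    finally show ?thesis by (simp add: n_def mult.commute)
  qed
  show ?thesis
  proof (cases "\<alpha> \<le> r")
    case True
    \<comment> \<open>The ceiling is at most 1 here, and the count without groups gives
      \<open>b \<le> 2 * (k + 1)\<close>.\<close>
    then have "\<lceil>real \<alpha> / real r\<rceil> \<le> 1" using r by (simp add: ceiling_le_iff divide_le_eq)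
    then have "real_of_int \<lceil>real \<alpha> / real r\<rceil> * real b \<le> 1 * real b" by (intro mult_right_mono) auto
    moreover have "b * m \<le> (k + 1) * a"
      using counts(2) unfolding m_def[symmetric] a_def[symmetric]
      by (metis one_less_numeral_iff power_le_imp_le_exp semiring_norm(76))
    then have "b * m \<le> (k + 1) * 2 * m" using a2m by (metis le_trans mult.assoc mult_le_mono2)
    then have "b \<le> (k + 1) * 2" using m mult_le_cancel2 by blast
    then have "real b \<le> real ((k + 1) * 2)" by (rule of_nat_mono)
    ultimately show ?thesis by simp
  next
    case False
    have "2 powr (real b * real m) = real (2 ^ (b * m))" using powr_realpow[of 2 "b * m"] by simp
    also have "\<dots> \<le> real (r ^ a * 2 ^ ((k + 1) * (n * r)))"
      using counts(1) unfolding m_def[symmetric] a_def[symmetric] n_def[symmetric] by (rule of_nat_mono)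
    also have "\<dots> = real r ^ a * 2 powr real ((k + 1) * (n * r))"
      using powr_realpow[of 2 "(k + 1) * (n * r)"] by simp
    also have "real r ^ a \<le> real r ^ (2 * m)" using r a2m by (intro power_increasing) auto
    also have "real r ^ (2 * m) \<le> (2 powr (real b / 4)) ^ (2 * m)" using r by (intro power_mono) auto
    also have "\<dots> = 2 powr (real b * real m / 2)" by (simp add: powr_power)
    also have "\<dots> * 2 powr real ((k + 1) * (n * r)) = 2 powr (real b * real m / 2 + real ((k + 1) * (n * r)))"
      by (simp add: powr_add)
    finally have "real b * real m \<le> real b * real m / 2 + real ((k + 1) * (n * r))" by simp
    then have "real b * real m \<le> 2 * (real (k + 1) * real n * real r)"
      by (simp add: algebra_simps)
    \<comment> \<open>Multiplying by \<open>\<alpha>\<close> allows \<open>\<alpha> * n\<close> to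
      be replaced by \<open>2 * m\<close>, after which \<open>m\<close> cancels.\<close>
    then have "real \<alpha> * (real b * real m) \<le> real \<alpha> * (2 * (real (k + 1) * real n * real r))"
      by (rule mult_left_mono) simp
    also have "\<dots> = 2 * real (k + 1) * real r * real (\<alpha> * n)" by simp
    also have "\<dots> \<le> 2 * real (k + 1) * real r * real (2 * m)"
      using le_trans[OF an a2m] by (intro mult_left_mono of_nat_mono) auto
    finally have "(real \<alpha> * real b) * real m \<le> (4 * real (k + 1) * real r) * real m" by (simp add: algebra_simps)
    then have "real \<alpha> * real b \<le> 4 * real (k + 1) * real r" using m by simp
    then have *: "real \<alpha> / real r * real b \<le> 4 * real (k + 1)" using r by (simp add: field_simps)
    have "1 \<le> real \<alpha> / real r" using False r by simp
    then have "real_of_int \<lceil>real \<alpha> / real r\<rceil> \<le> 2 * (real \<alpha> / real r)" by linarith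
    then have "real_of_int \<lceil>real \<alpha> / real r\<rceil> * real b \<le> 2 * (real \<alpha> / real r) * real b"
      by (rule mult_right_mono) simp
    then show ?thesis using * by simp
  qed
qed

section \<open>Colorings injective on neighborhoods\<close>

lemma greedy_coloring:
  assumes "finite V" "finite K" and sym: "\<And>x y. R x y \<Longrightarrow> R y x"
    and "\<And>x. x \<in> V \<Longrightarrow> card {y \<in> V. R x y} < card K"
  shows "\<exists>f. f ` V \<subseteq> K \<and> (\<forall>x\<in>V. \<forall>y\<in>V. x \<noteq> y \<longrightarrow> R x y \<longrightarrow> f x \<noteq> f y)"
  using assms(1,4)
proof (induction V)
  case empty
  then show ?case by simp
next
  case (insert x V)
  have "card {z \<in> V. R y z} < card K" if "y \<in> V" for y
  proof -
    have "card {z \<in> V. R y z} \<le> card {z \<in> insert x V. R y z}"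
      using insert.hyps by (intro card_mono) auto
    then show ?thesis using insert.prems[of y] that by simp
  qed
  then obtain f where f: "f ` V \<subseteq> K" "\<forall>x\<in>V. \<forall>y\<in>V. x \<noteq> y \<longrightarrow> R x y \<longrightarrow> f x \<noteq> f y"
    using insert.IH by blast
  have "card (f ` {y \<in> V. R x y}) \<le> card {y \<in> V. R x y}"
    using insert.hyps by (intro card_image_le) auto
  also have "\<dots> \<le> card {y \<in> insert x V. R x y}"
    using insert.hyps by (intro card_mono) auto
  also have "\<dots> < card K" using insert.prems by simp
  finally have "\<not> K \<subseteq> f ` {y \<in> V. R x y}"
    using insert.hyps card_mono[of "f ` {y \<in> V. R x y}" K] by auto
  then obtain c where c: "c \<in> K" "c \<notin> f ` {y \<in> V. R x y}" by blast
  show ?case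
  proof (intro exI[of _ "f(x := c)"] conjI ballI impI)
    show "(f(x := c)) ` insert x V \<subseteq> K" using f c by auto
    fix y z assume "y \<in> insert x V" "z \<in> insert x V" "y \<noteq> z" "R y z"
    then show "(f(x := c)) y \<noteq> (f(x := c)) z" using f(2) c sym by auto
  qed
qed

text \<open>Two vertices conflict if they have a common neighbor. The vertices in conflict with
  \<open>x\<close>, possibly \<open>x\<close> itself included, are neighbors of its at most
  \<open>\<Delta>\<close> neighbors, so they number at most \<open>\<Delta> * \<Delta>\<close> and
  greedy coloring applies.\<close>

lemma neighbor_colors:
  assumes C: "connected_graph C" and \<Delta>: "max_degree C = \<Delta>" and K: "finite K" "\<Delta> * \<Delta> < card K"
  obtains col where "col ` verts C \<subseteq> K" "\<And>v. inj_on col (neighbors C v)"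
proof -
  have sg: "simple_graph C" using C by (simp add: connected_graph_def)
  note e = simple_graph_edges[OF sg]
  have fin: "finite (verts C)" using sg by (simp add: simple_graph_def)
  have nv: "neighbors C v \<subseteq> verts C" for v using e(3) by (auto simp: neighbors_def)
  have finN: "finite (neighbors C v)" for v using nv fin finite_subset by blast
  have deg: "card (neighbors C v) \<le> \<Delta>" if "v \<in> verts C" for v
    using that fin \<Delta> by (auto simp: max_degree_def degree_def)
  define R where "R x y \<longleftrightarrow> (\<exists>v. x \<in> neighbors C v \<and> y \<in> neighbors C v)" for x y
  have "card {y \<in> verts C. R x y} < card K" if x: "x \<in> verts C" for x
  proof -
    have "{y \<in> verts C. R x y} \<subseteq> (\<Union>v\<in>neighbors C x. neighbors C v)"
      by (auto simp: R_def neighbors_def insert_commute)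
    then have "card {y \<in> verts C. R x y} \<le> card (\<Union>v\<in>neighbors C x. neighbors C v)"
      using finN by (intro card_mono) auto
    also have "\<dots> \<le> (\<Sum>v\<in>neighbors C x. card (neighbors C v))" by (rule card_UN_le[OF finN])
    also have "\<dots> \<le> (\<Sum>v\<in>neighbors C x. \<Delta>)" using nv by (intro sum_mono deg) auto
    also have "\<dots> \<le> \<Delta> * \<Delta>" using deg[OF x] by simp
    finally show ?thesis using K by simp
  qed
  moreover have "R y x" if "R x y" for x y using that by (auto simp: R_def)
  ultimately obtain col where colK: "col ` verts C \<subseteq> K"
      and col: "\<forall>x\<in>verts C. \<forall>y\<in>verts C. x \<noteq> y \<longrightarrow> R x y \<longrightarrow> col x \<noteq> col y"
    using greedy_coloring[OF fin K(1), of R] by blast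
  have "inj_on col (neighbors C v)" for v
  proof (rule inj_onI, rule ccontr)
    fix x y assume xy: "x \<in> neighbors C v" "y \<in> neighbors C v" "col x = col y" "x \<noteq> y"
    then have "R x y" "x \<in> verts C" "y \<in> verts C" using nv by (auto simp: R_def)
    then show False using col xy by blast
  qed
  then show ?thesis by (rule that[OF colK])
qed

section \<open>The verifier and its message format\<close>

text \<open>For an upper bound it suffices to give a verifier and to show that short accepted
  labelings of legal configurations exist; the prover picks one by \<open>SOME\<close>.\<close>

lemma verification_complexity_le:
  fixes S :: "'s pls"
  assumes mc: "mcast r \<F> S"
    and sound: "\<And>C l. C \<in> \<F> \<Longrightarrow> accepted S C l \<Longrightarrow> P C"
    and complete: "\<And>C. C \<in> \<F> \<Longrightarrow> P C \<Longrightarrow> \<exists>l. accepted S C l \<and>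
      (\<forall>v\<in>verts C. \<forall>i\<in>{1..degree C v}. length (message S C l v i) \<le> k)"
  shows "verification_complexity r \<F> P \<le> enat k"
proof -
  define good where "good C l \<longleftrightarrow> accepted S C l \<and>
      (\<forall>v\<in>verts C. \<forall>i\<in>{1..degree C v}. length (message S C l v i) \<le> k)" for C l
  define S' where "S' = S\<lparr>prover := \<lambda>C. SOME l. good C l\<rparr>"
  have msg: "message S' = message S" by (intro ext) (simp add: message_def S'_def)
  have "received S' = received S" by (intro ext) (simp add: received_def msg)
  then have acc: "accepted S' = accepted S" by (intro ext) (simp add: accepted_def S'_def)
  have good: "good C (prover S' C)" if "C \<in> \<F>" "P C" for C
  proof -
    have "\<exists>l. good C l" using complete[OF that] by (simp add: good_def)
    then show ?thesis by (simp add: S'_def someI_ex)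
  qed
  have "is_pls \<F> P S'" using good sound by (auto simp: is_pls_def acc good_def)
  moreover have "mcast r \<F> S'" using mc by (simp add: mcast_def msg)
  moreover have "max_message_length \<F> P S' \<le> enat k"
    using good by (auto simp: max_message_length_def msg good_def intro!: SUP_least)
  ultimately show ?thesis unfolding verification_complexity_def by (auto intro: INF_lower2)
qed

type_synonym label_data = "bits \<times> (bits \<times> nat) list"

text \<open>Label length is free, so a unary code does. Decoding is total, as the verifier has to
  cope with arbitrary labels.\<close>

definition encode_label :: "label_data \<Rightarrow> bits" where
  "encode_label d = replicate (to_nat d) True"

definition decode_label :: "bits \<Rightarrow> label_data" where
  "decode_label l = from_nat (length l)"

lemma decode_encode_label [simp]: "decode_label (encode_label d) = d"
  by (simp add: decode_label_def encode_label_def)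

text \<open>The header is the color of the sender; then comes one block per edge of group
  \<open>j\<close>, the color recorded for the neighbor followed by the string.\<close>

definition group_message :: "label_data \<Rightarrow> bits list \<Rightarrow> nat \<Rightarrow> bits" where
  "group_message d ss j = fst d @ concat (map (\<lambda>i. fst (snd d ! i) @ ss ! i)
     (filter (\<lambda>i. snd (snd d ! i) = j) [0..<length (snd d)]))"

text \<open>The existential stands for a parse that is unique for positive \<open>n\<close>; a
  message that cannot be parsed yields no block.\<close>

definition blocks :: "nat \<Rightarrow> nat \<Rightarrow> bits \<Rightarrow> bits set" where
  "blocks L n m = {x. \<exists>xs. drop L m = concat xs \<and> (\<forall>y\<in>set xs. length y = n) \<and> x \<in> set xs}"

lemma concat_equal_lengths:
  assumes "concat xs = concat ys" "\<forall>y\<in>set xs. length y = n" "\<forall>y\<in>set ys. length y = n" "0 < n"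
  shows "xs = ys"
proof (rule concat_injective[OF assms(1)])
  have "length (concat xs) = length xs * n" "length (concat ys) = length ys * n"
    using assms(2,3) by (induction xs, simp_all) (induction ys, simp_all)
  then show "length xs = length ys" using assms(1,4) by simp
  show "\<forall>(x, y)\<in>set (zip xs ys). length x = length y"
    using assms(2,3) by (metis (mono_tags, lifting) case_prodI2 set_zip_leftD set_zip_rightD)
qed

lemma blocks_append_concat:
  assumes "length c = L" "0 < n" "\<forall>y\<in>set xs. length y = n"
  shows "blocks L n (c @ concat xs) = set xs"
proof -
  have "ys = xs" if "concat xs = concat ys" "\<forall>y\<in>set ys. length y = n" for ys
    using concat_equal_lengths[OF that(1) assms(3) that(2) assms(2)] by simp
  then show ?thesis using assms by (auto simp: blocks_def)
qed

lemma blocks_group_message: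
  assumes "length (fst d) = L" "0 < n"
    and "\<And>i. i < length (snd d) \<Longrightarrow> length (fst (snd d ! i)) + length (ss ! i) = n"
  shows "blocks L n (group_message d ss j) =
    {fst (snd d ! i) @ ss ! i | i. i < length (snd d) \<and> snd (snd d ! i) = j}"
proof -
  have "blocks L n (group_message d ss j) = set (map (\<lambda>i. fst (snd d ! i) @ ss ! i)
      (filter (\<lambda>i. snd (snd d ! i) = j) [0..<length (snd d)]))"
    unfolding group_message_def by (rule blocks_append_concat) (use assms in auto)
  also have "\<dots> = {fst (snd d ! i) @ ss ! i | i. i < length (snd d) \<and> snd (snd d ! i) = j}" by auto
  finally show ?thesis .
qed

text \<open>An edge marked as incoming carries the message of group 0, so that for positive
  \<open>r\<close> labels of any kind yield at most \<open>r\<close> messages per node.\<close>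

definition selected_group :: "nat \<Rightarrow> nat \<Rightarrow> nat" where
  "selected_group r j = (if j < r then j else 0)"

text \<open>The label of a node holds its own color and, for each port, the color of the neighbor
  and a group number; group numbers below \<open>r\<close> mark the outgoing edges, all others the
  incoming ones.\<close>

definition ea_send :: "nat \<Rightarrow> 'x ea_state_scheme \<Rightarrow> bits \<Rightarrow> nat \<Rightarrow> bits" where
  "ea_send r s l i = group_message (decode_label l) (strings s)
     (selected_group r (snd (snd (decode_label l) ! (i - 1))))"

text \<open>Comparing headers with the recorded colors ties these to the colors the neighbors claim;
  distinctness then lets a tag single out one port. A node checks all blocks tagged with its own
  color, and on incoming edges insists that such a block arrives, so that an edge cannot escape the
  comparison by being declared incoming at both ends.\<close>

definition ea_decide :: "nat \<Rightarrow> nat \<Rightarrow> nat \<Rightarrow> 'x ea_state_scheme \<Rightarrow> bits \<Rightarrow> bits list \<Rightarrow> bool" where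
  "ea_decide L b r s l ms \<longleftrightarrow> (let c = fst (decode_label l); es = snd (decode_label l); ss = strings s in
     length es = length ss \<and> length c = L \<and> (\<forall>i<length es. length (fst (es ! i)) = L) \<and>
     distinct (map fst es) \<and>
     (\<forall>i<length es. take L (ms ! i) = fst (es ! i) \<and>
        (\<forall>x\<in>blocks L (L + b) (ms ! i). take L x = c \<longrightarrow> x = c @ ss ! i) \<and>
        (r \<le> snd (es ! i) \<longrightarrow> c @ ss ! i \<in> blocks L (L + b) (ms ! i))))"

definition ea_scheme :: "nat \<Rightarrow> nat \<Rightarrow> nat \<Rightarrow> 'x ea_state_scheme pls" where
  "ea_scheme L b r = \<lparr>prover = \<lambda>_ _. [], send = ea_send r, decide = ea_decide L b r\<rparr>"

lemma ea_scheme_message: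
  "message (ea_scheme L b r) C l v i = group_message (decode_label (l v)) (strings (state C v))
     (selected_group r (snd (snd (decode_label (l v)) ! (i - 1))))"
  by (simp add: message_def ea_scheme_def ea_send_def)

lemma ea_scheme_mcast:
  assumes "1 \<le> r"
  shows "mcast r \<F> (ea_scheme L b r)"
  unfolding mcast_def
proof (intro ballI allI)
  fix C :: "'a ea_state_scheme config" and l v
  let ?m = "group_message (decode_label (l v)) (strings (state C v))"
  have "message (ea_scheme L b r) C l v ` {1..degree C v} \<subseteq> ?m ` {..<r}"
    using assms by (auto simp: ea_scheme_message selected_group_def)
  then have "card (message (ea_scheme L b r) C l v ` {1..degree C v}) \<le> card (?m ` {..<r})"
    by (intro card_mono) auto
  also have "\<dots> \<le> r" using card_image_le[of "{..<r}" ?m] by simp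
  finally show "card (message (ea_scheme L b r) C l v ` {1..degree C v}) \<le> r" .
qed

lemma received_nth:
  "i < degree C v \<Longrightarrow> received S C l v ! i =
    message S C l (neighbor_at C v (Suc i)) (port C (neighbor_at C v (Suc i)) v)"
  by (simp add: received_def Let_def del: upt_Suc)

lemma configuration_ports:
  assumes C: "configuration C" and vu: "{v, u} \<in> edges C"
  shows "v \<in> verts C" "u \<in> verts C" "v \<noteq> u" "u \<in> neighbors C v"
    "port C v u \<in> {1..degree C v}" "neighbor_at C v (port C v u) = u"
proof -
  have sg: "simple_graph C" using C by (simp add: configuration_def connected_graph_def)
  show v: "v \<in> verts C" "u \<in> verts C" using simple_graph_edges(3)[OF sg] vu by auto
  show "v \<noteq> u" using sg vu by (force simp: simple_graph_def doubleton_eq_iff)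
  show u: "u \<in> neighbors C v" using vu by (simp add: neighbors_def)
  have p: "bij_betw (port C v) (neighbors C v) {1..degree C v}"
    using C v by (simp add: configuration_def)
  show "port C v u \<in> {1..degree C v}" using bij_betwE[OF p] u by blast
  show "neighbor_at C v (port C v u) = u" using p u by (simp add: neighbor_at_def bij_betw_def)
qed

lemma configuration_neighbor_at:
  assumes C: "configuration C" and v: "v \<in> verts C" and i: "i \<in> {1..degree C v}"
  shows "{v, neighbor_at C v i} \<in> edges C" "port C v (neighbor_at C v i) = i"
proof -
  have p: "bij_betw (port C v) (neighbors C v) {1..degree C v}"
    using C v by (simp add: configuration_def)
  then have "i \<in> port C v ` neighbors C v" using i by (simp add: bij_betw_def)
  then show "port C v (neighbor_at C v i) = i" "{v, neighbor_at C v i} \<in> edges C"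
    using inv_into_into[of i "port C v" "neighbors C v"]
    by (simp_all add: neighbor_at_def f_inv_into_f neighbors_def)
qed

section \<open>Soundness, completeness and message length of the scheme\<close>

text \<open>The labels need not come from a coloring or from forests. Whichever way \<open>v\<close>
  marks an edge, the strings are compared: by the neighbor \<open>u\<close> if the edge is outgoing
  at \<open>v\<close>, and by \<open>v\<close> otherwise.\<close>

lemma ea_scheme_sound:
  fixes C :: "'x ea_state_scheme config"
  assumes C: "C \<in> EA_family b" and b: "0 < b" and acc: "accepted (ea_scheme L b r) C l"
  shows "EA C"
proof -
  let ?c = "\<lambda>v. fst (decode_label (l v))" and ?es = "\<lambda>v. snd (decode_label (l v))"
  let ?ss = "\<lambda>v. strings (state C v)" and ?ms = "received (ea_scheme L b r) C l"
  have conf: "configuration C" and len: "\<And>v. v \<in> verts C \<Longrightarrow> length (?ss v) = degree C v"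
    and str: "\<And>v x. v \<in> verts C \<Longrightarrow> x \<in> set (?ss v) \<Longrightarrow> length x = b"
    using C by (auto simp: EA_family_def)
  have dec: "length (?es v) = degree C v" "length (?c v) = L"
      "\<And>i. i < degree C v \<Longrightarrow> length (fst (?es v ! i)) = L" "distinct (map fst (?es v))"
      "\<And>i. i < degree C v \<Longrightarrow> take L (?ms v ! i) = fst (?es v ! i)"
      "\<And>i x. i < degree C v \<Longrightarrow> x \<in> blocks L (L + b) (?ms v ! i) \<Longrightarrow> take L x = ?c v \<Longrightarrow> x = ?c v @ ?ss v ! i"
      "\<And>i. i < degree C v \<Longrightarrow> r \<le> snd (?es v ! i) \<Longrightarrow> ?c v @ ?ss v ! i \<in> blocks L (L + b) (?ms v ! i)"
    if v: "v \<in> verts C" for v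
  proof -
    have "ea_decide L b r (state C v) (l v) (?ms v)" using acc v by (simp add: accepted_def ea_scheme_def)
    then show "length (?es v) = degree C v" "length (?c v) = L"
      "\<And>i. i < degree C v \<Longrightarrow> length (fst (?es v ! i)) = L" "distinct (map fst (?es v))"
      "\<And>i. i < degree C v \<Longrightarrow> take L (?ms v ! i) = fst (?es v ! i)"
      "\<And>i x. i < degree C v \<Longrightarrow> x \<in> blocks L (L + b) (?ms v ! i) \<Longrightarrow> take L x = ?c v \<Longrightarrow> x = ?c v @ ?ss v ! i"
      "\<And>i. i < degree C v \<Longrightarrow> r \<le> snd (?es v ! i) \<Longrightarrow> ?c v @ ?ss v ! i \<in> blocks L (L + b) (?ms v ! i)"
      using len[OF v] by (auto simp: ea_decide_def Let_def)
  qed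
  have idx: "port C v u - 1 < degree C v" "neighbor_at C v (Suc (port C v u - 1)) = u"
      "?ms v ! (port C v u - 1) = group_message (decode_label (l u)) (?ss u)
        (selected_group r (snd (?es u ! (port C u v - 1))))"
    if "{v, u} \<in> edges C" for v u
  proof -
    note p = configuration_ports[OF conf that]
    show 1: "port C v u - 1 < degree C v" and 2: "neighbor_at C v (Suc (port C v u - 1)) = u"
      using p(5,6) by auto
    show "?ms v ! (port C v u - 1) = group_message (decode_label (l u)) (?ss u)
        (selected_group r (snd (?es u ! (port C u v - 1))))"
      unfolding received_nth[OF 1] 2 ea_scheme_message ..
  qed
  have blk: "blocks L (L + b) (group_message (decode_label (l u)) (?ss u) j) =
      {fst (?es u ! i) @ ?ss u ! i | i. i < degree C u \<and> snd (?es u ! i) = j}" if u: "u \<in> verts C" for u j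
  proof -
    have "length (fst (?es u ! i)) + length (?ss u ! i) = L + b" if "i < length (?es u)" for i
      using that dec(1,3)[OF u] str[OF u nth_mem] len[OF u] by simp
    then show ?thesis using blocks_group_message[of "decode_label (l u)" L "L + b" "?ss u" j] dec(1,2)[OF u] b
      by simp
  qed
  have col: "fst (?es v ! (port C v u - 1)) = ?c u" if vu: "{v, u} \<in> edges C" for v u
  proof -
    note p = configuration_ports[OF conf vu]
    show ?thesis using dec(5)[OF p(1) idx(1)[OF vu]] dec(2)[OF p(2)]
      unfolding idx(3)[OF vu] by (simp add: group_message_def)
  qed
  have agree: "?ss v ! (port C v u - 1) = ?ss u ! (port C u v - 1)" if vu: "{v, u} \<in> edges C" for v u
  proof -
    have uv: "{u, v} \<in> edges C" using vu by (simp add: insert_commute)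
    note p = configuration_ports[OF conf vu]
    let ?i = "port C v u - 1" and ?j = "port C u v - 1"
    note i = idx(1)[OF vu] and j = idx(1)[OF uv]
    show ?thesis
    proof (cases "snd (?es v ! ?i) < r")
      case True
      then have "?c u @ ?ss v ! ?i \<in> blocks L (L + b) (?ms u ! ?j)"
        unfolding idx(3)[OF uv] blk[OF p(1)] using i col[OF vu]
        by (auto simp: selected_group_def intro!: exI[of _ ?i])
      then have "?c u @ ?ss v ! ?i = ?c u @ ?ss u ! ?j"
        using dec(6)[OF p(2) j] dec(2)[OF p(2)] by simp
      then show ?thesis by simp
    next
      case False
      then have "?c v @ ?ss v ! ?i \<in> blocks L (L + b) (?ms v ! ?i)"
        using dec(7)[OF p(1) i] by simp
      then obtain k where k: "k < degree C u" "?c v @ ?ss v ! ?i = fst (?es u ! k) @ ?ss u ! k"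
        unfolding idx(3)[OF vu] blk[OF p(2)] by blast
      then have eq: "?c v = fst (?es u ! k)" "?ss v ! ?i = ?ss u ! k"
        using dec(2)[OF p(1)] dec(3)[OF p(2) k(1)] by simp_all
      \<comment> \<open>Colors recorded at \<open>u\<close> are distinct, so the block that
        \<open>v\<close> found is the one for the port towards \<open>v\<close>.\<close>
      then have "map fst (?es u) ! k = map fst (?es u) ! ?j"
        using col[OF uv] k j dec(1)[OF p(2)] by simp
      then have "k = ?j"
        by (rule nth_eq_iff_index_eq[THEN iffD1, OF dec(4)[OF p(2)], rotated 2])
          (use dec(1)[OF p(2)] k j in simp_all)
      then show ?thesis using eq by simp
    qed
  qed
  show ?thesis unfolding EA_def edge_string_def
    by (intro allI impI agree[symmetric])
qed

text \<open>In the honest labels, an edge whose far end is the parent in forest i goes to group i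
  div q. The forest index determines the neighbor, so at most \<open>q\<close> edges share a group,
  and a message is a header of \<open>L\<close> bits and at most \<open>q\<close> blocks of
  \<open>L + b\<close> bits.\<close>

lemma ea_scheme_complete:
  fixes C :: "'x ea_state_scheme config"
  assumes C: "C \<in> EA_family b" and EA: "EA C" and b: "0 < b"
    and \<alpha>: "arboricity C = \<alpha>" "\<alpha> \<le> q * r"
    and \<Delta>: "max_degree C = \<Delta>" "\<Delta> * \<Delta> < 2 ^ L"
  shows "\<exists>l. accepted (ea_scheme L b r) C l \<and> (\<forall>v\<in>verts C. \<forall>i\<in>{1..degree C v}.
    length (message (ea_scheme L b r) C l v i) \<le> L + q * (L + b))"
proof -
  let ?ss = "\<lambda>v. strings (state C v)" and ?nb = "neighbor_at C"
  have conf: "configuration C" and len: "\<And>v. v \<in> verts C \<Longrightarrow> length (?ss v) = degree C v"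
    and str: "\<And>v x. v \<in> verts C \<Longrightarrow> x \<in> set (?ss v) \<Longrightarrow> length x = b"
    using C by (auto simp: EA_family_def)
  have conn: "connected_graph C" using conf by (simp add: configuration_def)
  then have sg: "simple_graph C" by (simp add: connected_graph_def)
  note e = simple_graph_edges[OF sg]
  obtain col where "col ` verts C \<subseteq> {l :: bits. length l = L}" and inj: "\<And>v. inj_on col (neighbors C v)"
    using neighbor_colors[OF conn \<Delta>(1) finite_bits_eq] \<Delta>(2) by (metis card_bits_eq)
  then have col: "\<And>v. v \<in> verts C \<Longrightarrow> length (col v) = L" by blast
  obtain F where F: "\<forall>i<\<alpha>. F i \<subseteq> edges C \<and> acyclic_edges (F i)" "(\<Union>i<\<alpha>. F i) = edges C"
    using forest_decomposable_arboricity[OF e(1,2)] \<alpha>(1) by (auto simp: forest_decomposable_def)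
  have "\<exists>h. \<forall>e\<in>F i. \<exists>v. e = {v, h v}" if "i < \<alpha>" for i
  proof (rule forest_parent)
    have Fi: "F i \<subseteq> edges C" "acyclic_edges (F i)" using F(1) that by auto
    then show "finite (F i)" "acyclic_edges (F i)" using e(1) finite_subset by auto
    show "simple_edges (F i)" using Fi(1) e(2) unfolding simple_edges_def by blast
  qed
  then obtain h where h: "\<And>i e. i < \<alpha> \<Longrightarrow> e \<in> F i \<Longrightarrow> \<exists>v. e = {v, h i v}" by metis
  define idx where "idx v u = (LEAST i. i < \<alpha> \<and> h i v = u)" for v u
  define out where "out v u \<longleftrightarrow> (\<exists>i<\<alpha>. h i v = u)" for v u
  \<comment> \<open>By \<open>\<alpha> \<le> q * r\<close> the quotients stay below
    \<open>r\<close>, and \<open>r\<close> itself marks an incoming edge. An edge may be outgoing at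
    both ends, which is harmless; incoming at both ends is excluded by
    \<open>oriented\<close>.\<close>
  define grp where "grp v u = (if out v u then idx v u div q else r)" for v u
  have idx: "idx v u < \<alpha>" "h (idx v u) v = u" if "out v u" for v u
    using LeastI_ex[of "\<lambda>i. i < \<alpha> \<and> h i v = u"] that by (auto simp: idx_def out_def)
  have oriented: "out v u \<or> out u v" if vu: "{v, u} \<in> edges C" for v u
  proof -
    obtain i where i: "i < \<alpha>" "{v, u} \<in> F i" using vu unfolding F(2)[symmetric] by blast
    then obtain x where "{v, u} = {x, h i x}" using h[OF i] by blast
    then have "h i v = u \<or> h i u = v" by (auto simp: doubleton_eq_iff)
    then show ?thesis using i(1) by (auto simp: out_def)
  qed
  have grp: "grp v u < r" if "out v u" for v u
  proof -
    have "idx v u < r * q" using idx(1)[OF that] \<alpha>(2) by (simp add: mult.commute)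
    then show ?thesis using that by (simp add: grp_def less_mult_imp_div_less)
  qed
  define es where "es v = map (\<lambda>i. (col (?nb v i), grp v (?nb v i))) [1..<Suc (degree C v)]" for v
  define l where "l v = encode_label (col v, es v)" for v
  have dec: "decode_label (l v) = (col v, es v)" for v by (simp add: l_def)
  have es_len: "length (es v) = degree C v" for v by (simp add: es_def)
  have es_nth: "es v ! i = (col (?nb v (Suc i)), grp v (?nb v (Suc i)))" if "i < degree C v" for v i
    using that by (simp add: es_def del: upt_Suc)
  have nb: "{v, ?nb v (Suc i)} \<in> edges C" "port C v (?nb v (Suc i)) = Suc i" "?nb v (Suc i) \<in> verts C"
      "?nb v (Suc i) \<in> neighbors C v"
    if "v \<in> verts C" "i < degree C v" for v i
  proof -
    show *: "{v, ?nb v (Suc i)} \<in> edges C" "port C v (?nb v (Suc i)) = Suc i"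
      using configuration_neighbor_at[OF conf that(1), of "Suc i"] that(2) by auto
    show "?nb v (Suc i) \<in> verts C" "?nb v (Suc i) \<in> neighbors C v"
      using configuration_ports[OF conf *(1)] by auto
  qed
  have block_len: "length (fst (es v ! i)) + length (?ss v ! i) = L + b" if "v \<in> verts C" "i < degree C v" for v i
    using that col nb(3)[OF that] str[OF that(1)] len[OF that(1)] by (simp add: es_nth)
  have blk: "blocks L (L + b) (group_message (decode_label (l v)) (?ss v) j) =
      {fst (es v ! i) @ ?ss v ! i | i. i < degree C v \<and> snd (es v ! i) = j}" if v: "v \<in> verts C" for v j
    using blocks_group_message[of "decode_label (l v)" L "L + b" "?ss v" j] col[OF v] b
      block_len[OF v] by (simp add: dec es_len)
  have "ea_decide L b r (state C v) (l v) (received (ea_scheme L b r) C l v)" if v: "v \<in> verts C" for v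
  proof -
    let ?ms = "received (ea_scheme L b r) C l v"
    have "distinct (map fst (es v))"
    proof -
      have "inj_on (\<lambda>i. col (?nb v i)) {1..degree C v}"
      proof (rule inj_onI)
        fix i j assume ij: "i \<in> {1..degree C v}" "j \<in> {1..degree C v}" "col (?nb v i) = col (?nb v j)"
        note ni = configuration_neighbor_at[OF conf v ij(1)] and nj = configuration_neighbor_at[OF conf v ij(2)]
        have "?nb v i = ?nb v j"
          using inj_onD[OF inj[of v] ij(3)] ni(1) nj(1) by (simp add: neighbors_def)
        then show "i = j" using ni(2) nj(2) by metis
      qed
      moreover have "set [1..<Suc (degree C v)] = {1..degree C v}" by auto
      ultimately show ?thesis by (simp add: es_def distinct_map comp_def del: upt_Suc)
    qed
    moreover have "take L (?ms ! i) = fst (es v ! i) \<and>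
        (\<forall>x\<in>blocks L (L + b) (?ms ! i). take L x = col v \<longrightarrow> x = col v @ ?ss v ! i) \<and>
        (r \<le> snd (es v ! i) \<longrightarrow> col v @ ?ss v ! i \<in> blocks L (L + b) (?ms ! i))"
      if i: "i < degree C v" for i
    proof -
      define u where "u = ?nb v (Suc i)"
      note n = nb[OF v i, folded u_def]
      have uv: "{u, v} \<in> edges C" using n(1) by (simp add: insert_commute)
      note p = configuration_ports[OF conf uv]
      define k where "k = port C u v - 1"
      have k: "k < degree C u" "?nb u (Suc k) = v" using p(5,6) by (auto simp: k_def)
      have ms: "?ms ! i = group_message (decode_label (l u)) (?ss u) (selected_group r (snd (es u ! k)))"
        unfolding received_nth[OF i] ea_scheme_message u_def[symmetric] by (simp add: dec k_def)
      have "edge_string C v u = edge_string C u v" using EA uv by (simp add: EA_def)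
      then have agree: "?ss v ! i = ?ss u ! k" by (simp add: edge_string_def n(2) k_def)
      have "take L (?ms ! i) = fst (es v ! i)"
        using col[OF n(3)] i by (simp add: ms group_message_def dec es_nth u_def)
      moreover have "x = col v @ ?ss v ! i"
        if x: "x \<in> blocks L (L + b) (?ms ! i)" "take L x = col v" for x
      proof -
        obtain k' where k': "k' < degree C u" "x = fst (es u ! k') @ ?ss u ! k'"
          using x(1) unfolding ms blk[OF n(3)] by blast
        note n' = nb[OF n(3) k'(1)]
        have "col (?nb u (Suc k')) = col v"
          using x(2) k' col[OF n'(3)] by (simp add: es_nth)
        then have "?nb u (Suc k') = v"
          using inj_onD[OF inj[of u]] n'(4) p(4) by blast
        then have "k' = k" using n'(2) by (simp add: k_def)
        then show ?thesis using k k' by (simp add: es_nth agree)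
      qed
      moreover have "col v @ ?ss v ! i \<in> blocks L (L + b) (?ms ! i)" if "r \<le> snd (es v ! i)"
      proof -
        have "\<not> out v u" using that grp[of v u] i by (auto simp: es_nth u_def)
        then have "grp u v < r" using oriented[OF n(1)] grp by blast
        then show ?thesis unfolding ms blk[OF n(3)] agree using k
          by (auto simp: es_nth selected_group_def intro!: exI[of _ k])
      qed
      ultimately show ?thesis by blast
    qed
    moreover have "length (fst (es v ! i)) = L" if "i < degree C v" for i
      using col[OF nb(3)[OF v that]] that by (simp add: es_nth)
    ultimately show ?thesis
      using len[OF v] col[OF v] by (simp add: ea_decide_def Let_def dec es_len)
  qed
  then have "accepted (ea_scheme L b r) C l" by (simp add: accepted_def ea_scheme_def)
  moreover have "length (message (ea_scheme L b r) C l v i) \<le> L + q * (L + b)"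
    if v: "v \<in> verts C" and i: "i \<in> {1..degree C v}" for v i
  proof -
    define j where "j = selected_group r (snd (es v ! (i - 1)))"
    \<comment> \<open>With \<open>r = 0\<close> there would be no forest and hence no edge, yet port
      \<open>i\<close> exists; the same argument later yields \<open>q > 0\<close>.\<close>
    have "r > 0"
    proof (rule ccontr)
      assume "\<not> r > 0"
      then have "edges C = {}" using \<alpha>(2) F(2) by auto
      then show False using configuration_neighbor_at(1)[OF conf v i] by simp
    qed
    then have "j < r" by (simp add: j_def selected_group_def)
    let ?is = "filter (\<lambda>i. snd (es v ! i) = j) [0..<degree C v]"
    have grouped: "out v (?nb v (Suc i))" "idx v (?nb v (Suc i)) div q = j" if "i \<in> set ?is" for i
      using that \<open>j < r\<close> by (auto simp: es_nth grp_def split: if_splits)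
    have "length ?is = card (set ?is)" by (rule distinct_card[symmetric]) simp
    also have "\<dots> \<le> card {j * q..<j * q + q}"
    proof (rule card_inj_on_le)
      show "inj_on (\<lambda>i. idx v (?nb v (Suc i))) (set ?is)"
      proof (rule inj_onI)
        fix i i' assume i: "i \<in> set ?is" "i' \<in> set ?is" "idx v (?nb v (Suc i)) = idx v (?nb v (Suc i'))"
        have "?nb v (Suc i) = h (idx v (?nb v (Suc i))) v"
          by (rule idx(2)[OF grouped(1)[OF i(1)], symmetric])
        also have "\<dots> = ?nb v (Suc i')"
          unfolding i(3) by (rule idx(2)[OF grouped(1)[OF i(2)]])
        finally have eq: "?nb v (Suc i) = ?nb v (Suc i')" .
        have "i < degree C v" "i' < degree C v" using i(1,2) by auto
        then have "Suc i = Suc i'"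
          using nb(2)[OF v, of i] nb(2)[OF v, of i'] unfolding eq by (simp only:)
        then show "i = i'" by simp
      qed
      have "q > 0"
      proof (rule ccontr)
        assume "\<not> q > 0"
        then have "edges C = {}" using \<alpha>(2) F(2) by auto
        then show False using configuration_neighbor_at(1)[OF conf v i] by simp
      qed
      then have "x \<in> {j * q..<j * q + q}" if "x div q = j" for x
        using that by (metis atLeastLessThan_iff div_times_less_eq_dividend dividend_less_div_times add.commute)
      then show "(\<lambda>i. idx v (?nb v (Suc i))) ` set ?is \<subseteq> {j * q..<j * q + q}"
        using grouped(2) by blast
    qed simp
    finally have card: "length ?is \<le> q" by simp
    have "length (concat (map (\<lambda>i. fst (es v ! i) @ ?ss v ! i) ?is)) = (\<Sum>i\<leftarrow>?is. L + b)"
      unfolding length_concat map_map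
      by (intro arg_cong[where f = sum_list] map_cong) (auto simp: block_len[OF v])
    also have "\<dots> = length ?is * (L + b)" by (simp add: sum_list_triv)
    also have "\<dots> \<le> q * (L + b)" using card by (rule mult_right_mono) simp
    finally show ?thesis using col[OF v]
      by (simp add: ea_scheme_message group_message_def dec es_len j_def)
  qed
  ultimately show ?thesis by blast
qed

section \<open>Both bounds combined\<close>

lemma ea_upper_bound:
  assumes b: "0 < b" and r: "1 \<le> r" and q: "\<alpha> \<le> q * r" and L: "\<Delta> * \<Delta> < 2 ^ L"
  shows "verification_complexity r
    (restrict_family \<alpha> \<Delta> (EA_family b :: 'x ea_state_scheme config set)) EA \<le> enat (L + q * (L + b))"
proof (rule verification_complexity_le[OF ea_scheme_mcast[OF r, of _ L b]])
  fix C :: "'x ea_state_scheme config" and l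
  assume "C \<in> restrict_family \<alpha> \<Delta> (EA_family b)"
  then have C: "C \<in> EA_family b" "arboricity C = \<alpha>" "max_degree C = \<Delta>"
    by (auto simp: restrict_family_def)
  show "EA C" if "accepted (ea_scheme L b r) C l"
    using ea_scheme_sound[OF C(1) b that] .
  show "\<exists>l. accepted (ea_scheme L b r) C l \<and> (\<forall>v\<in>verts C. \<forall>i\<in>{1..degree C v}.
      length (message (ea_scheme L b r) C l v i) \<le> L + q * (L + b))" if "EA C"
    using ea_scheme_complete[OF C(1) that b C(2) q C(3) L] .
qed

text \<open>The claimed bound is 0 for \<open>b = 0\<close>, which headers and tags of positive
  length cannot meet. All strings are empty then, so every configuration is legal and empty messages
  do.\<close>

lemma ea_upper_bound_zero:
  assumes r: "1 \<le> r"
  shows "verification_complexity r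
    (restrict_family \<alpha> \<Delta> (EA_family 0 :: 'x ea_state_scheme config set)) EA \<le> enat 0"
proof (rule verification_complexity_le)
  define S :: "'x ea_state_scheme pls" where
    "S = \<lparr>prover = \<lambda>_ _. [], send = \<lambda>_ _ _. [], decide = \<lambda>_ _ _. True\<rparr>"
  have msg: "message S C l v i = []" for C l v i by (simp add: S_def message_def)
  show "mcast r (restrict_family \<alpha> \<Delta> (EA_family 0)) S"
    using r by (auto simp: mcast_def msg image_constant_conv)
  fix C :: "'x ea_state_scheme config" and l
  assume C: "C \<in> restrict_family \<alpha> \<Delta> (EA_family 0)"
  have "edge_string C v u = []" if vu: "{v, u} \<in> edges C" for v u
  proof -
    have "configuration C" using C by (simp add: restrict_family_def EA_family_def)
    note p = configuration_ports[OF this vu]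
    have "edge_string C v u \<in> set (strings (state C v))"
      using C p(1,5) unfolding edge_string_def
      by (intro nth_mem) (auto simp: restrict_family_def EA_family_def)
    then show ?thesis using C p(1) by (auto simp: restrict_family_def EA_family_def)
  qed
  then show "EA C" by (simp add: EA_def insert_commute)
  show "\<exists>l. accepted S C l \<and> (\<forall>v\<in>verts C. \<forall>i\<in>{1..degree C v}. length (message S C l v i) \<le> 0)"
    by (simp add: accepted_def msg) (simp add: S_def)
qed

text \<open>A finite infimum of extended naturals is attained: some scheme stays strictly below
  \<open>k + 1\<close>.\<close>

lemma verification_complexity_attained:
  assumes "verification_complexity r \<F> P = enat k"
  obtains S where "is_pls \<F> P S" "mcast r \<F> S" "max_message_length \<F> P S \<le> enat k"
proof -
  let ?X = "{S. is_pls \<F> P S \<and> mcast r \<F> S}"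
  have "Inf (max_message_length \<F> P ` ?X) < enat (Suc k)"
    using assms by (simp add: verification_complexity_def)
  then obtain S where "S \<in> ?X" "max_message_length \<F> P S < enat (Suc k)"
    unfolding Inf_less_iff by blast
  then show ?thesis
    by (intro that[of S]) (auto simp: less_Suc_eq_le[symmetric] elim!: less_enatE)
qed

theorem theorem2:
  "\<exists>b\<^sub>0 :: nat. \<forall>c :: real. c > 0 \<longrightarrow>
     (\<exists>C\<^sub>1 > 0. \<exists>C\<^sub>2 > 0. \<forall>(\<alpha> :: nat) (\<Delta> :: nat) (b :: nat) (r :: nat).
        (\<exists>G :: graph. connected_graph G \<and> arboricity G = \<alpha> \<and> max_degree G = \<Delta>) \<longrightarrow>
        real b \<ge> c * log 2 (real \<Delta>) \<longrightarrow>
        1 \<le> r \<longrightarrow> r \<le> \<Delta> \<longrightarrow> real r \<le> 2 powr (real b / 4) \<longrightarrow>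
        (\<exists>k. verification_complexity r
               (restrict_family \<alpha> \<Delta> (EA_family b :: 'x ea_state_scheme config set)) EA = enat k \<and>
             real k \<le> C\<^sub>2 * (real_of_int \<lceil>real \<alpha> / real r\<rceil> * real b) \<and>
             (b \<ge> b\<^sub>0 \<longrightarrow> C\<^sub>1 * (real_of_int \<lceil>real \<alpha> / real r\<rceil> * real b) \<le> real k)))"
proof (rule exI[of _ 16], intro allI impI)
  fix c :: real assume c: "c > 0"
  show "\<exists>C\<^sub>1 > 0. \<exists>C\<^sub>2 > 0. \<forall>(\<alpha> :: nat) (\<Delta> :: nat) (b :: nat) (r :: nat).
        (\<exists>G :: graph. connected_graph G \<and> arboricity G = \<alpha> \<and> max_degree G = \<Delta>) \<longrightarrow>
        real b \<ge> c * log 2 (real \<Delta>) \<longrightarrow>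
        1 \<le> r \<longrightarrow> r \<le> \<Delta> \<longrightarrow> real r \<le> 2 powr (real b / 4) \<longrightarrow>
        (\<exists>k. verification_complexity r
               (restrict_family \<alpha> \<Delta> (EA_family b :: 'x ea_state_scheme config set)) EA = enat k \<and>
             real k \<le> C\<^sub>2 * (real_of_int \<lceil>real \<alpha> / real r\<rceil> * real b) \<and>
             (b \<ge> 16 \<longrightarrow> C\<^sub>1 * (real_of_int \<lceil>real \<alpha> / real r\<rceil> * real b) \<le> real k))"
  \<comment> \<open>\<open>4 / c + 5\<close> comes from inserting
    \<open>L \<le> 2 * b / c + 2 * b\<close> into \<open>2 * L + b\<close>; \<open>1 / 16\<close> is
    half of the \<open>1 / 8\<close> of the lower bound, the other half absorbing the summand 1 in
    \<open>k + 1\<close>.\<close>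
  proof (rule exI[of _ "1 / 16"], intro conjI, simp, rule exI[of _ "4 / c + 5"], intro conjI allI impI)
    show "4 / c + 5 > 0" using c by (simp add: add_pos_pos)
    fix \<alpha> \<Delta> b r :: nat
    assume "\<exists>G :: graph. connected_graph G \<and> arboricity G = \<alpha> \<and> max_degree G = \<Delta>"
      and b\<Delta>: "real b \<ge> c * log 2 (real \<Delta>)"
      and r: "1 \<le> r" "r \<le> \<Delta>" "real r \<le> 2 powr (real b / 4)"
    then obtain G :: graph where G: "connected_graph G" "arboricity G = \<alpha>" "max_degree G = \<Delta>" by blast
    have \<Delta>: "1 \<le> \<Delta>" using r by linarith
    obtain H :: graph and E u where H: "connected_graph H" "arboricity H = \<alpha>" "max_degree H = \<Delta>" "1 \<le> \<alpha>"
        "E \<subseteq> edges H" "E \<noteq> {}" and deg: "\<And>v. v \<in> \<Union>E \<Longrightarrow> \<alpha> \<le> card {w. {v, w} \<in> E}"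
      and iso: "\<And>v w. v \<in> \<Union>E \<Longrightarrow> v \<noteq> u \<Longrightarrow> {v, w} \<in> edges H \<Longrightarrow> {v, w} \<in> E"
      using dense_core_graph[OF G \<Delta>] by blast
    let ?\<F> = "restrict_family \<alpha> \<Delta> (EA_family b :: 'x ea_state_scheme config set)"
    let ?q = "\<lceil>real \<alpha> / real r\<rceil>"
    have q1: "1 \<le> ?q" using H(4) r(1) by (simp add: one_le_ceiling)
    have "\<exists>k. verification_complexity r ?\<F> EA \<le> enat k \<and> real k \<le> (4 / c + 5) * (real_of_int ?q * real b)"
    proof (cases "b = 0")
      case True
      then show ?thesis using ea_upper_bound_zero[OF r(1)] by (intro exI[of _ 0]) simp
    next
      case False
      define q where "q = nat ?q"
      have q: "real q = real_of_int ?q" using q1 by (simp add: q_def)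
      have "real \<alpha> / real r \<le> real q" unfolding q by (rule le_of_int_ceiling)
      then have "real \<alpha> \<le> real (q * r)" using r(1) by (simp add: divide_le_eq)
      then have \<alpha>q: "\<alpha> \<le> q * r" by (simp only: of_nat_le_iff)
      define t where "t = nat \<lfloor>log 2 (real \<Delta>)\<rfloor>"
      \<comment> \<open>\<open>2 ^ (t + 1)\<close> exceeds \<open>\<Delta>\<close>, so twice that
        many bits give more than \<open>\<Delta> * \<Delta>\<close> colors.\<close>
      define L where "L = 2 * (t + 1)"
      have log0: "0 \<le> log 2 (real \<Delta>)" using \<Delta> by simp
      then have t: "real t \<le> log 2 (real \<Delta>)" "log 2 (real \<Delta>) < real (t + 1)"
        unfolding t_def by linarith+
      have "real \<Delta> < 2 powr real (t + 1)" using t(2) \<Delta> by (simp add: log_less_iff)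
      then have "real \<Delta> < real (2 ^ (t + 1))" using powr_realpow[of 2 "t + 1"] by simp
      then have "\<Delta> < 2 ^ (t + 1)" by (simp only: of_nat_less_iff)
      then have "\<Delta> * \<Delta> < 2 ^ (t + 1) * 2 ^ (t + 1)" by (intro mult_strict_mono) auto
      also have "\<dots> = 2 ^ L" unfolding L_def mult_2 by (rule power_add[symmetric])
      finally have \<Delta>L: "\<Delta> * \<Delta> < 2 ^ L" .
      have "log 2 (real \<Delta>) \<le> real b / c" using b\<Delta> c by (simp add: field_simps)
      then have "real L \<le> 2 * (real b / c) + 2 * real b" using t(1) False by (simp add: L_def)
      then have "real L + (real L + real b) \<le> 4 * (real b / c) + 5 * real b" by linarith
      also have "\<dots> = (4 / c + 5) * real b" by (simp add: algebra_simps)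
      finally have "real L + (real L + real b) \<le> (4 / c + 5) * real b" .
      then have "real q * (real L + (real L + real b)) \<le> real q * ((4 / c + 5) * real b)"
        by (rule mult_left_mono) simp
      \<comment> \<open>The header occurs once, but charging it to each of the \<open>q\<close>
        blocks gives the bound its product form.\<close>
      moreover have "real L \<le> real q * real L" using q q1 by (simp add: mult_le_cancel_right1)
      ultimately have "real (L + q * (L + b)) \<le> (4 / c + 5) * (real q * real b)"
        by (simp add: algebra_simps)
      then show ?thesis using ea_upper_bound[OF _ r(1) \<alpha>q \<Delta>L] False unfolding q by blast
    qed
    then obtain k\<^sub>0 where k\<^sub>0: "verification_complexity r ?\<F> EA \<le> enat k\<^sub>0"
      "real k\<^sub>0 \<le> (4 / c + 5) * (real_of_int ?q * real b)" by blast
    then obtain k where k: "verification_complexity r ?\<F> EA = enat k" "k \<le> k\<^sub>0"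
      by (metis enat_ile enat_ord_simps(1))
    obtain S where S: "is_pls ?\<F> EA S" "mcast r ?\<F> S" "max_message_length ?\<F> EA S \<le> enat k"
      using verification_complexity_attained[OF k(1)] .
    have low: "real_of_int ?q * real b \<le> 8 * (real k + 1)"
      by (rule ea_lower_bound[OF H(1,5,6) _ deg H(4) r(1,3), unfolded H(2,3), where u = u, OF _ _ S]) (rule iso)
    have "1 / 16 * (real_of_int ?q * real b) \<le> real k" if "b \<ge> 16"
    proof -
      \<comment> \<open>The product is at least 16, so the additive 8 in \<open>low\<close> is at
        most half of it.\<close>
      have "1 * 16 \<le> real_of_int ?q * real b" using q1 that by (intro mult_mono) auto
      then show ?thesis using low by simp
    qed
    then show "\<exists>k. verification_complexity r ?\<F> EA = enat k \<and>
        real k \<le> (4 / c + 5) * (real_of_int ?q * real b) \<and>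
        (b \<ge> 16 \<longrightarrow> 1 / 16 * (real_of_int ?q * real b) \<le> real k)"
      using k k\<^sub>0(2) by (intro exI[of _ k]) auto
  qed
qed

end
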